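(* Let $M10$ be the real Lie algebra with basis $x_1,\dots,x_6$ and nonzero brackets $[x_1,x_2]=x_3$, $[x_1,x_3]=x_5$, $[x_1,x_4]=x_6$, $[x_2,x_3]=-x_6$, $[x_2,x_4]=x_5$. The set $\mathfrak{X}_{M10}$ of all complex structures on $M10$ is a 10-dimensional submanifold of $\mathbb{R}^{36}$.
   Context: Brackets of basis vectors not listed (and not obtained by antisymmetry) are zero. A complex structure on a real Lie algebra $\mathfrak{g}$ is a linear map $J:\mathfrak{g}\to\mathfrak{g}$ with $J^2=-1$ and $[JX,JY]-[X,Y]-J[JX,Y]-J[X,JY]=0$ for all $X,Y\in\mathfrak{g}$. $J$ is identified with its $6\times 6$ matrix in the basis $(x_j)$; so the set of complex structures is a subset of $\mathbb{R}^{36}$. "Submanifold" means smooth ($C^\infty$) submanifold. *)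

theory Defs
  imports "HOL-Analysis.Analysis"
begin

text \<open>
  Smooth maps on open subsets of a Euclidean space. The derivative is applied to each fixed
  direction \<open>v\<close> so that the recursion stays within one type; as the domain is finite-dimensional,
  this is the usual notion of a \<open>C\<^sup>n\<close> map.
\<close>

fun Ck_on :: "nat \<Rightarrow> 'a::euclidean_space set \<Rightarrow> ('a \<Rightarrow> 'b::real_normed_vector) \<Rightarrow> bool" where
  "Ck_on 0 U f \<longleftrightarrow> continuous_on U f"
| "Ck_on (Suc n) U f \<longleftrightarrow>
     (\<forall>x\<in>U. f differentiable (at x)) \<and>
     (\<forall>v. Ck_on n U (\<lambda>x. frechet_derivative f (at x) v))"

definition smooth_on :: "'a::euclidean_space set \<Rightarrow> ('a \<Rightarrow> 'b::real_normed_vector) \<Rightarrow> bool" where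
  "smooth_on U f \<longleftrightarrow> (\<forall>n. Ck_on n U f)"

definition smooth_diffeomorphism ::
  "'a::euclidean_space set \<Rightarrow> 'b::euclidean_space set \<Rightarrow> ('a \<Rightarrow> 'b) \<Rightarrow> ('b \<Rightarrow> 'a) \<Rightarrow> bool" where
  "smooth_diffeomorphism U V \<phi> \<psi> \<longleftrightarrow>
     open U \<and> open V \<and> homeomorphism U V \<phi> \<psi> \<and> smooth_on U \<phi> \<and> smooth_on V \<psi>"

text \<open>
  Embedded submanifolds, by slice charts: around each of its points, \<open>M\<close> is straightened by an
  ambient diffeomorphism onto an open piece of a \<open>k\<close>-dimensional linear subspace. The empty set
  is not counted as \<open>k\<close>-dimensional.
\<close>

definition smooth_submanifold :: "nat \<Rightarrow> 'a::euclidean_space set \<Rightarrow> bool" where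
  "smooth_submanifold k M \<longleftrightarrow>
     M \<noteq> {} \<and>
     (\<forall>p\<in>M. \<exists>U V \<phi> \<psi> S. p \<in> U \<and> smooth_diffeomorphism U (V :: 'a set) \<phi> \<psi> \<and>
        subspace S \<and> dim S = k \<and> \<phi> ` (M \<inter> U) = S \<inter> V)"

definition complex_structure ::
  "('g::real_vector \<Rightarrow> 'g \<Rightarrow> 'g) \<Rightarrow> ('g \<Rightarrow> 'g) \<Rightarrow> bool" where
  "complex_structure br J \<longleftrightarrow>
     linear J \<and>
     (\<forall>X. J (J X) = - X) \<and>
     (\<forall>X Y. br (J X) (J Y) - br X Y - J (br (J X) Y) - J (br X (J Y)) = 0)"

text \<open>
  The Lie algebra \<open>M10\<close> lives on \<open>real ^ 6\<close> with \<open>x\<^sub>j = axis j 1\<close>; note that \<open>6 = 0\<close> in the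
  index type \<open>6\<close>, so that \<open>1, \<dots>, 6\<close> are its six distinct elements. The table lists the
  brackets \<open>[x\<^sub>i, x\<^sub>j]\<close> with \<open>i < j\<close>; the bracket is its antisymmetric bilinear extension.
\<close>

definition M10_table :: "6 \<Rightarrow> 6 \<Rightarrow> real ^ 6" where
  "M10_table i j =
     (if i = 1 \<and> j = 2 then axis 3 1
      else if i = 1 \<and> j = 3 then axis 5 1
      else if i = 1 \<and> j = 4 then axis 6 1
      else if i = 2 \<and> j = 3 then - axis 6 1
      else if i = 2 \<and> j = 4 then axis 5 1
      else 0)"

definition M10_bracket :: "real ^ 6 \<Rightarrow> real ^ 6 \<Rightarrow> real ^ 6" where
  "M10_bracket X Y =
     (\<Sum>i\<in>UNIV. \<Sum>j\<in>UNIV. (X $ i * Y $ j) *\<^sub>R (M10_table i j - M10_table j i))"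

lemma M10_bracket_axis:
  "M10_bracket (axis i 1) (axis j 1) = M10_table i j - M10_table j i"
proof -
  have "M10_bracket (axis i 1) (axis j 1) =
      (\<Sum>k\<in>UNIV. if k = i then \<Sum>l\<in>UNIV. if l = j then M10_table k l - M10_table l k else 0 else 0)"
    unfolding M10_bracket_def
  proof (intro sum.cong refl)
    fix k :: 6
    have "(axis i 1 $ k * axis j 1 $ l) *\<^sub>R (M10_table k l - M10_table l k) =
        (if k = i then if l = j then M10_table k l - M10_table l k else 0 else 0)" for l
      by (simp add: axis_def)
    then show "(\<Sum>l\<in>UNIV. (axis i 1 $ k * axis j 1 $ l) *\<^sub>R (M10_table k l - M10_table l k)) =
        (if k = i then \<Sum>l\<in>UNIV. if l = j then M10_table k l - M10_table l k else 0 else 0)"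
      by simp
  qed
  then show ?thesis by simp
qed

lemma exhaust_6: "x = 1 \<or> x = 2 \<or> x = 3 \<or> x = 4 \<or> x = 5 \<or> x = (6::6)"
proof (induct x)
  case (of_int z)
  then have "0 \<le> z" and "z < 6" by simp_all
  then have "z = 0 \<or> z = 1 \<or> z = 2 \<or> z = 3 \<or> z = 4 \<or> z = 5" by arith
  then show ?case by auto
qed

lemma UNIV_6: "UNIV = {1, 2, 3, 4, 5, 6::6}"
  using exhaust_6 by auto

lemma forall_6: "(\<forall>i::6. P i) \<longleftrightarrow> P 1 \<and> P 2 \<and> P 3 \<and> P 4 \<and> P 5 \<and> P 6"
  by (metis exhaust_6)

lemma distinct_6:
  "(1::6) \<noteq> 2"
  "(1::6) \<noteq> 3"
  "(1::6) \<noteq> 4"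
  "(1::6) \<noteq> 5"
  "(1::6) \<noteq> 6"
  "(2::6) \<noteq> 1"
  "(2::6) \<noteq> 3"
  "(2::6) \<noteq> 4"
  "(2::6) \<noteq> 5"
  "(2::6) \<noteq> 6"
  "(3::6) \<noteq> 1"
  "(3::6) \<noteq> 2"
  "(3::6) \<noteq> 4"
  "(3::6) \<noteq> 5"
  "(3::6) \<noteq> 6"
  "(4::6) \<noteq> 1"
  "(4::6) \<noteq> 2"
  "(4::6) \<noteq> 3"
  "(4::6) \<noteq> 5"
  "(4::6) \<noteq> 6"
  "(5::6) \<noteq> 1"
  "(5::6) \<noteq> 2"
  "(5::6) \<noteq> 3"
  "(5::6) \<noteq> 4"
  "(5::6) \<noteq> 6"
  "(6::6) \<noteq> 1"
  "(6::6) \<noteq> 2"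
  "(6::6) \<noteq> 3"
  "(6::6) \<noteq> 4"
  "(6::6) \<noteq> 5"
  by simp_all

lemma M10_bracket_nth:
  "M10_bracket X Y $ 1 = 0"
  "M10_bracket X Y $ 2 = 0"
  "M10_bracket X Y $ 3 = X $ 1 * Y $ 2 - X $ 2 * Y $ 1"
  "M10_bracket X Y $ 4 = 0"
  "M10_bracket X Y $ 5 = X $ 1 * Y $ 3 - X $ 3 * Y $ 1 + X $ 2 * Y $ 4 - X $ 4 * Y $ 2"
  "M10_bracket X Y $ 6 = X $ 1 * Y $ 4 - X $ 4 * Y $ 1 - X $ 2 * Y $ 3 + X $ 3 * Y $ 2"
  by (simp_all only: M10_bracket_def M10_table_def UNIV_6 axis_def sum_component
      vector_scaleR_component vector_minus_component vector_uminus_component vec_lambda_beta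
      zero_index sum.insert sum.empty finite.intros insert_iff empty_iff distinct_6
      if_True if_False simp_thms real_scaleR_def)
    (simp_all add: algebra_simps)

lemma bilinear_M10_bracket: "bilinear M10_bracket"
  by (auto simp: bilinear_def linear_iff vec_eq_iff forall_6 M10_bracket_nth algebra_simps)

lemma M10_bracket_self: "M10_bracket X X = 0"
  by (simp add: vec_eq_iff forall_6 M10_bracket_nth)

lemma M10_bracket_jacobi:
  "M10_bracket X (M10_bracket Y Z) + M10_bracket Y (M10_bracket Z X)
     + M10_bracket Z (M10_bracket X Y) = 0"
  by (simp add: vec_eq_iff forall_6 M10_bracket_nth algebra_simps)

text \<open>The set of complex structures, each identified with its \<open>6 \<times> 6\<close> matrix in the basis \<open>x\<^sub>j\<close>.\<close>

definition X_M10 :: "(real ^ 6 ^ 6) set" where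
  "X_M10 = matrix ` {J. complex_structure M10_bracket J}"

end

(*
  In the complex coordinates z = X1 + i X2, w = X3 + i X4, u = X5 + i X6 the bracket is
  [(z, w, u), (z', w', u')] = (0, Im (cnj z z'), cnj z w' - cnj z' w). If c is central, then ad (J c)
  commutes with J; this forces J to preserve the center z = w = 0 and then the ideal z = 0. So J is
  lower block triangular. As J^2 = -1, J is determined by its columns at x1, x3, x5, where only the
  entries below or on the diagonal blocks survive; with A, C, F the diagonal blocks, the Nijenhuis
  condition reduces to the single complex equation F (a + c) = a c - 1, where a = cnj (A 1) and
  c = C 1. In terms of the first columns (p, q), (r, s), (f, g) of A, C, F this is a pair of real
  equations that is affine in each of the three columns, and the three determinants never vanish
  together. Hence X_M10 is locally the graph of a rational map over 10 of the matrix entries.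
*)

theory Submission
  imports Defs
begin

section \<open>Smooth maps and graphs\<close>

lemma Ck_on_cong:
  assumes "open U" "\<And>x. x \<in> U \<Longrightarrow> f x = g x" "Ck_on n U f"
  shows "Ck_on n U g"
  using assms(2,3)
proof (induction n arbitrary: f g)
  case 0
  then show ?case using continuous_on_cong by (metis Ck_on.simps(1))
next
  case (Suc n)
  have diff: "g differentiable (at x)" if "x \<in> U" for x
    using Suc.prems that \<open>open U\<close> unfolding differentiable_def Ck_on.simps
    by (metis has_derivative_transform_within_open)
  have deriv: "frechet_derivative f (at x) v = frechet_derivative g (at x) v" if "x \<in> U" for x v
    by (rule fun_cong[OF frechet_derivative_transform_within_open[OF _ \<open>open U\<close> that Suc.prems(1)]])
      (use Suc.prems(2) that in simp)
  have "Ck_on n U (\<lambda>x. frechet_derivative g (at x) v)" for v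
    by (rule Suc.IH[OF deriv]) (use Suc.prems(2) in simp_all)
  with diff show ?case by simp
qed

text \<open>Since derivatives at points of an open set are unique, any explicit formula
  \<open>D\<close> may replace the choice term \<open>frechet_derivative\<close>. The closure rules
  below all go through this form.\<close>

lemma Ck_on_SucI:
  assumes "open U" "\<And>x. x \<in> U \<Longrightarrow> (f has_derivative D x) (at x)"
    and "\<And>v. Ck_on n U (\<lambda>x. D x v)"
  shows "Ck_on (Suc n) U f"
proof -
  have "D x = frechet_derivative f (at x)" if "x \<in> U" for x
    using assms(2)[OF that] by (rule frechet_derivative_at)
  then have "Ck_on n U (\<lambda>x. frechet_derivative f (at x) v)" for v
    by (intro Ck_on_cong[OF \<open>open U\<close> _ assms(3)]) auto
  moreover have "f differentiable (at x)" if "x \<in> U" for x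
    using assms(2)[OF that] by (auto simp: differentiable_def)
  ultimately show ?thesis by simp
qed

lemma Ck_on_Suc_has_derivative:
  assumes "Ck_on (Suc n) U f" "x \<in> U"
  shows "(f has_derivative frechet_derivative f (at x)) (at x)"
  using assms by (simp add: frechet_derivative_works)

lemma Ck_on_Suc_imp:
  assumes "Ck_on (Suc n) U f"
  shows "Ck_on n U f"
  using assms
proof (induction n arbitrary: f)
  case 0
  then show ?case
    by (auto intro!: differentiable_imp_continuous_on simp: differentiable_on_def
        differentiable_at_withinI)
next
  case (Suc n)
  then show ?case by (metis Ck_on.simps(2))
qed

lemma Ck_on_const: "open U \<Longrightarrow> Ck_on n U (\<lambda>x. c)"
proof (induction n arbitrary: c)
  case (Suc n)
  then show ?case by (intro Ck_on_SucI[where D = "\<lambda>_ _. 0"]) auto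
qed simp

lemma Ck_on_add:
  assumes "open U" "Ck_on n U f" "Ck_on n U g"
  shows "Ck_on n U (\<lambda>x. f x + g x)"
  using assms(2,3)
proof (induction n arbitrary: f g)
  case 0
  then show ?case by (auto intro: continuous_intros)
next
  case (Suc n)
  show ?case
    by (rule Ck_on_SucI[OF \<open>open U\<close>
          has_derivative_add[OF Suc.prems[THEN Ck_on_Suc_has_derivative]]])
      (use Suc in auto)
qed

text \<open>Both summands of the product rule are again products with factors of class C^n, so the
  induction must keep \<open>f\<close> and \<open>g\<close> arbitrary; the undifferentiated factor
  loses one order by \<open>Ck_on_Suc_imp\<close>. Stated for bounded bilinear maps, it serves
  multiplication, scaling and inner products alike.\<close>

lemma (in bounded_bilinear) Ck_on_prod:
  assumes "open U" "Ck_on n U f" "Ck_on n U g"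
  shows "Ck_on n U (\<lambda>x. prod (f x) (g x))"
  using assms(2,3)
proof (induction n arbitrary: f g)
  case 0
  then show ?case by (auto intro: continuous_on)
next
  case (Suc n)
  show ?case
  proof (rule Ck_on_SucI[OF \<open>open U\<close> FDERIV[OF Suc.prems[THEN Ck_on_Suc_has_derivative]]])
    show "Ck_on n U (\<lambda>x. prod (f x) (frechet_derivative g (at x) v) +
        prod (frechet_derivative f (at x) v) (g x))" for v
      by (intro Ck_on_add[OF \<open>open U\<close>] Suc.IH Ck_on_Suc_imp[OF Suc.prems(1)]
          Ck_on_Suc_imp[OF Suc.prems(2)]) (use Suc.prems in auto)
  qed
qed

text \<open>The derivative of 1/f contains only f' and 1/f itself, and the induction hypothesis
  already supplies 1/f to the lower order needed there.\<close>

lemma Ck_on_inverse: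
  fixes f :: "'a::euclidean_space \<Rightarrow> real"
  assumes "open U" "Ck_on n U f" "\<And>x. x \<in> U \<Longrightarrow> f x \<noteq> 0"
  shows "Ck_on n U (\<lambda>x. inverse (f x))"
  using assms(2)
proof (induction n)
  case 0
  then show ?case using assms(3) by (auto intro!: continuous_intros)
next
  case (Suc n)
  note mult = bounded_bilinear.Ck_on_prod[OF bounded_bilinear_mult \<open>open U\<close>]
  have inv: "Ck_on n U (\<lambda>x. inverse (f x))"
    using Suc Ck_on_Suc_imp by blast
  show ?case
  proof (rule Ck_on_SucI[OF \<open>open U\<close>])
    show "((\<lambda>x. inverse (f x)) has_derivative
        (\<lambda>v. (- 1) * (inverse (f x) * frechet_derivative f (at x) v * inverse (f x)))) (at x)"
      if "x \<in> U" for x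
      using Deriv.has_derivative_inverse[OF assms(3)[OF that]
          Ck_on_Suc_has_derivative[OF Suc.prems that]] by simp
    show "Ck_on n U (\<lambda>x. (- 1) * (inverse (f x) * frechet_derivative f (at x) v * inverse (f x)))"
      for v
      using Suc.prems by (intro mult inv Ck_on_const \<open>open U\<close>) auto
  qed
qed

lemma Ck_on_bounded_linear:
  assumes "open U" "bounded_linear f"
  shows "Ck_on n U f"
proof (cases n)
  case 0
  then show ?thesis using assms by (simp add: linear_continuous_on)
next
  case (Suc m)
  then show ?thesis
    using assms by (simp del: Ck_on.simps add: Ck_on_SucI[where D = "\<lambda>_. f"] Ck_on_const
        bounded_linear_imp_has_derivative)
qed

section \<open>Closure rules for smooth maps\<close>

lemma smooth_on_const: "open U \<Longrightarrow> smooth_on U (\<lambda>x. c)"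
  by (simp add: smooth_on_def Ck_on_const)

lemma smooth_on_linear:
  "open U \<Longrightarrow> linear f \<Longrightarrow> smooth_on U (f :: 'a::euclidean_space \<Rightarrow> 'b::real_normed_vector)"
  by (simp add: smooth_on_def Ck_on_bounded_linear linear_conv_bounded_linear)

lemma smooth_on_add:
  "open U \<Longrightarrow> smooth_on U f \<Longrightarrow> smooth_on U g \<Longrightarrow> smooth_on U (\<lambda>x. f x + g x)"
  by (simp add: smooth_on_def Ck_on_add)

lemma smooth_on_scaleR:
  "open U \<Longrightarrow> smooth_on U f \<Longrightarrow> smooth_on U g \<Longrightarrow> smooth_on U (\<lambda>x. f x *\<^sub>R g x)"
  by (simp add: smooth_on_def bounded_bilinear.Ck_on_prod[OF bounded_bilinear_scaleR])

lemma smooth_on_mult: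
  fixes f g :: "'a::euclidean_space \<Rightarrow> 'b::real_normed_algebra"
  shows "open U \<Longrightarrow> smooth_on U f \<Longrightarrow> smooth_on U g \<Longrightarrow> smooth_on U (\<lambda>x. f x * g x)"
  by (simp add: smooth_on_def bounded_bilinear.Ck_on_prod[OF bounded_bilinear_mult])

lemma smooth_on_minus:
  assumes "open U" "smooth_on U f"
  shows "smooth_on U (\<lambda>x. - f x)"
  using smooth_on_scaleR[OF assms(1) smooth_on_const[OF assms(1), of "- 1 :: real"] assms(2)]
  by simp

lemma smooth_on_diff:
  "open U \<Longrightarrow> smooth_on U f \<Longrightarrow> smooth_on U g \<Longrightarrow> smooth_on U (\<lambda>x. f x - g x)"
  using smooth_on_add[OF _ _ smooth_on_minus, of U f g] by simp

lemma smooth_on_divide: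
  fixes f g :: "'a::euclidean_space \<Rightarrow> real"
  assumes "open U" "smooth_on U f" "smooth_on U g" "\<And>x. x \<in> U \<Longrightarrow> g x \<noteq> 0"
  shows "smooth_on U (\<lambda>x. f x / g x)"
proof -
  have "smooth_on U (\<lambda>x. inverse (g x))"
    using assms by (simp add: smooth_on_def Ck_on_inverse)
  then show ?thesis
    using smooth_on_mult assms by (simp add: divide_inverse)
qed

lemma smooth_on_sum:
  assumes "open U" "\<And>i. i \<in> I \<Longrightarrow> smooth_on U (f i)"
  shows "smooth_on U (\<lambda>x. \<Sum>i\<in>I. f i x)"
  using assms(2)
  by (induction I rule: infinite_finite_induct) (auto intro!: smooth_on_const smooth_on_add assms(1))

lemma smooth_on_euclidean:
  fixes f :: "'a::euclidean_space \<Rightarrow> 'b::euclidean_space"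
  assumes "open U" "\<And>b. b \<in> Basis \<Longrightarrow> smooth_on U (\<lambda>x. f x \<bullet> b)"
  shows "smooth_on U f"
proof -
  have "smooth_on U (\<lambda>x. \<Sum>b\<in>Basis. (f x \<bullet> b) *\<^sub>R b)"
    by (intro smooth_on_sum smooth_on_scaleR smooth_on_const assms)
  then show ?thesis by (simp add: euclidean_representation)
qed

lemma smooth_on_matrix:
  fixes f :: "'a::euclidean_space \<Rightarrow> real ^ 'n ^ 'm"
  assumes "open U" "\<And>i j. smooth_on U (\<lambda>x. f x $ i $ j)"
  shows "smooth_on U f"
  by (rule smooth_on_euclidean[OF assms(1)])
    (use assms(2) in \<open>auto simp: Basis_vec_def inner_axis\<close>)

lemma smooth_on_entry:
  "open U \<Longrightarrow> smooth_on U (\<lambda>x :: real ^ 'n::finite ^ 'm::finite. x $ i $ j)"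
  by (rule smooth_on_linear) (simp_all add: linear_iff)

lemma smooth_on_imp_continuous_on: "smooth_on U f \<Longrightarrow> continuous_on U f"
  unfolding smooth_on_def using Ck_on.simps(1) by blast

text \<open>\<open>H\<close> depends only on \<open>P x\<close> and keeps it fixed, so x = H x
  describes a graph over the range of \<open>P\<close>. The difference H x - P x lies in the kernel
  of \<open>P\<close> and is constant along the fibres of \<open>P\<close>; subtracting it is
  therefore a shear, undone by adding it back, and it flattens the graph onto the range of
  \<open>P\<close>. As \<open>U\<close> is a union of fibres, the shear maps \<open>U\<close> onto
  itself, and V = U.\<close>

lemma graph_chart:
  fixes H P :: "'a::euclidean_space \<Rightarrow> 'a"
  assumes "open U" "linear P" "\<And>x. P (P x) = P x"
    and U: "\<And>x. P x \<in> U \<longleftrightarrow> x \<in> U"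
    and H: "smooth_on U H" "\<And>x. H (P x) = H x" "\<And>x. P (H x) = P x"
    and M: "\<And>x. x \<in> U \<Longrightarrow> x \<in> M \<longleftrightarrow> x = H x"
  shows "\<exists>V \<phi> \<psi>. smooth_diffeomorphism U V \<phi> \<psi> \<and> \<phi> ` (M \<inter> U) = range P \<inter> V"
proof -
  define \<phi> where "\<phi> x = x - H x + P x" for x
  define \<psi> where "\<psi> x = x + H x - P x" for x
  note lin = linear_add[OF \<open>linear P\<close>] linear_diff[OF \<open>linear P\<close>]
  have P\<phi>: "P (\<phi> x) = P x" and P\<psi>: "P (\<psi> x) = P x" for x
    by (simp_all add: \<phi>_def \<psi>_def lin H assms(3))
  have H\<phi>: "H (\<phi> x) = H x" and H\<psi>: "H (\<psi> x) = H x" for x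
    using H(2) P\<phi> P\<psi> by metis+
  have inv: "\<psi> (\<phi> x) = x" "\<phi> (\<psi> x) = x" for x
    unfolding \<psi>_def[of "\<phi> x"] \<phi>_def[of "\<psi> x"] P\<phi> P\<psi> H\<phi> H\<psi> by (simp_all add: \<phi>_def \<psi>_def)
  have memU: "\<phi> x \<in> U \<longleftrightarrow> x \<in> U" "\<psi> x \<in> U \<longleftrightarrow> x \<in> U" for x
    using U P\<phi> P\<psi> by metis+
  have img: "\<phi> ` U = U" "\<psi> ` U = U"
    using memU inv by (auto simp: image_iff) (use inv in \<open>metis memU\<close>)+
  have smooth: "smooth_on U \<phi>" "smooth_on U \<psi>"
    unfolding \<phi>_def[abs_def] \<psi>_def[abs_def]
    by (intro smooth_on_add smooth_on_diff smooth_on_linear assms linear_ident)+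
  have "smooth_diffeomorphism U U \<phi> \<psi>"
    unfolding smooth_diffeomorphism_def homeomorphism_def
    using \<open>open U\<close> img inv smooth smooth[THEN smooth_on_imp_continuous_on] by simp
  moreover have "\<phi> ` (M \<inter> U) = range P \<inter> U"
  proof (intro subset_antisym subsetI)
    fix y assume "y \<in> \<phi> ` (M \<inter> U)"
    then obtain x where x: "x \<in> M" "x \<in> U" "y = \<phi> x" by auto
    then have "y = P x" using M[of x] unfolding \<phi>_def by simp
    then show "y \<in> range P \<inter> U" using x memU(1)[of x] by (metis IntI rangeI)
  next
    fix y assume "y \<in> range P \<inter> U"
    then obtain x where "y = P x" "y \<in> U" by blast
    then have y: "P y = y" "y \<in> U" using assms(3)[of x] by simp_all
    then have "\<psi> y = H y" by (simp add: \<psi>_def)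
    then have "\<psi> y = H (\<psi> y)" unfolding H\<psi> .
    moreover have U: "\<psi> y \<in> U" using memU(2)[of y] y(2) by blast
    ultimately have "\<psi> y \<in> M \<inter> U" using M[OF U] by blast
    then have "\<phi> (\<psi> y) \<in> \<phi> ` (M \<inter> U)" by (rule imageI)
    then show "y \<in> \<phi> ` (M \<inter> U)" by (simp only: inv)
  qed
  ultimately show ?thesis by blast
qed

section \<open>Coordinate projections on the space of matrices\<close>

definition restrict_entries :: "('m \<times> 'n) set \<Rightarrow> real ^ 'n ^ 'm \<Rightarrow> real ^ 'n ^ 'm" where
  "restrict_entries I x = (\<chi> i j. if (i, j) \<in> I then x $ i $ j else 0)"

lemma linear_restrict_entries: "linear (restrict_entries I)"
  by (auto simp: restrict_entries_def linear_iff vec_eq_iff)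

text \<open>The range is the coordinate subspace spanned by the elementary matrices at positions in
  \<open>I\<close>; it is rewritten as the common zero set of the other coordinates to match
  \<open>dim_substandard\<close>.\<close>

lemma dim_range_restrict_entries:
  fixes I :: "('m::finite \<times> 'n::finite) set"
  shows "dim (range (restrict_entries I)) = card I"
proof -
  define d where "d = (\<lambda>(i, j). axis i (axis j 1) :: real ^ 'n ^ 'm) ` I"
  have inj: "inj_on (\<lambda>(i, j). axis i (axis j 1) :: real ^ 'n ^ 'm) I"
    by (auto simp: inj_on_def axis_eq_axis)
  have "range (restrict_entries I) = {x. \<forall>b\<in>Basis. b \<notin> d \<longrightarrow> x \<bullet> b = 0}"
  proof (intro subset_antisym subsetI)
    fix x assume "x \<in> range (restrict_entries I)"
    then show "x \<in> {x. \<forall>b\<in>Basis. b \<notin> d \<longrightarrow> x \<bullet> b = 0}"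
      by (auto simp: Basis_vec_def inner_axis restrict_entries_def d_def)
  next
    fix x :: "real ^ 'n ^ 'm" assume x: "x \<in> {x. \<forall>b\<in>Basis. b \<notin> d \<longrightarrow> x \<bullet> b = 0}"
    have "x $ i $ j = 0" if "(i, j) \<notin> I" for i j
    proof -
      have "axis i (axis j 1) \<notin> d" using that by (auto simp: d_def axis_eq_axis)
      then have "x \<bullet> axis i (axis j 1) = 0" using x by (auto simp: Basis_vec_def)
      then show ?thesis by (simp add: inner_axis)
    qed
    then have "x = restrict_entries I x" by (auto simp: restrict_entries_def vec_eq_iff)
    then show "x \<in> range (restrict_entries I)" by blast
  qed
  moreover have "d \<subseteq> Basis" by (auto simp: d_def Basis_vec_def)
  ultimately show ?thesis
    using dim_substandard[of d] card_image[OF inj] by (simp add: d_def)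
qed

section \<open>Complex structures on M10\<close>

definition nijenhuis :: "(real ^ 6 \<Rightarrow> real ^ 6) \<Rightarrow> real ^ 6 \<Rightarrow> real ^ 6 \<Rightarrow> real ^ 6" where
  "nijenhuis J X Y = M10_bracket (J X) (J Y) - M10_bracket X Y
     - J (M10_bracket (J X) Y) - J (M10_bracket X (J Y))"

lemma complex_structure_iff:
  "complex_structure M10_bracket J \<longleftrightarrow>
    linear J \<and> (\<forall>X. J (J X) = - X) \<and> (\<forall>X Y. nijenhuis J X Y = 0)"
  by (simp add: complex_structure_def nijenhuis_def)

lemma vec6_expand:
  fixes X :: "real ^ 6"
  shows "X = X$1 *\<^sub>R axis 1 1 + X$2 *\<^sub>R axis 2 1 + X$3 *\<^sub>R axis 3 1
           + X$4 *\<^sub>R axis 4 1 + X$5 *\<^sub>R axis 5 1 + X$6 *\<^sub>R axis 6 1"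
  by (simp add: vec_eq_iff forall_6 axis_def)

lemma linear_expand6:
  fixes J :: "real ^ 6 \<Rightarrow> 'a::real_vector"
  assumes "linear J"
  shows "J X = X$1 *\<^sub>R J (axis 1 1) + X$2 *\<^sub>R J (axis 2 1) + X$3 *\<^sub>R J (axis 3 1)
           + X$4 *\<^sub>R J (axis 4 1) + X$5 *\<^sub>R J (axis 5 1) + X$6 *\<^sub>R J (axis 6 1)"
  by (subst vec6_expand[of X]) (simp only: linear_add[OF assms] linear_cmul[OF assms])

text \<open>A real eigenvalue t would satisfy t * t = -1.\<close>

lemma no_real_eigenvector:
  fixes v :: "'a::real_vector"
  assumes "linear J" "J (J v) = - v" "J v = t *\<^sub>R v"
  shows "v = 0"
proof -
  have "(t * t + 1) *\<^sub>R v = 0"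
    using assms by (simp add: linear_cmul algebra_simps)
  moreover have "t * t + 1 \<noteq> 0" using zero_le_square[of t] by linarith
  ultimately show ?thesis by simp
qed

section \<open>Invariance of the center and of the ideal spanned by x3, ..., x6\<close>

context
  fixes J :: "real ^ 6 \<Rightarrow> real ^ 6"
  assumes cs: "complex_structure M10_bracket J"
begin

lemma linJ: "linear J" and JJ: "J (J X) = - X" and NJ: "nijenhuis J X Y = 0"
  using cs by (auto simp: complex_structure_iff)

text \<open>For central \<open>c\<close>, two of the four terms of the Nijenhuis condition
  vanish.\<close>

lemma ad_commute:
  assumes "\<And>Y. M10_bracket c Y = 0"
  shows "M10_bracket (J c) (J Y) = J (M10_bracket (J c) Y)"
  using NJ[of c Y] assms by (simp add: nijenhuis_def linear_0[OF linJ])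

lemma central: "c$1 = 0 \<Longrightarrow> c$2 = 0 \<Longrightarrow> c$3 = 0 \<Longrightarrow> c$4 = 0 \<Longrightarrow> M10_bracket c Y = 0"
  by (simp add: vec_eq_iff forall_6 M10_bracket_nth)

lemma J_center_12:
  assumes c: "c$1 = 0" "c$2 = 0" "c$3 = 0" "c$4 = 0"
  shows "J c $ 1 = 0 \<and> J c $ 2 = 0"
proof (rule ccontr)
  assume ne: "\<not> ?thesis"
  define T where "T = M10_bracket (J c)"
  define x y where "x = J c $ 1" and "y = J c $ 2"
  define v :: "real ^ 6" where "v = x *\<^sub>R axis 5 1 - y *\<^sub>R axis 6 1"
  have TJ: "T (J Y) = J (T Y)" for Y
    unfolding T_def using ad_commute central c by blast
  \<comment> \<open>The image of \<open>T \<circ> T\<close> is a line, and \<open>J\<close> would have to preserve it.\<close>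
  have TT: "T (T Y) = (x * Y$2 - y * Y$1) *\<^sub>R v" for Y
    by (simp add: T_def v_def x_def y_def vec_eq_iff forall_6 M10_bracket_nth axis_def algebra_simps)
  \<comment> \<open>This is the vector (x, y) turned by a right angle, which gives the linear form
    in \<open>TT\<close> the value x * x + y * y.\<close>
  define Y :: "real ^ 6" where "Y = x *\<^sub>R axis 2 1 - y *\<^sub>R axis 1 1"
  define k where "k = x * x + y * y"
  have k: "k \<noteq> 0"
    using ne by (simp add: k_def x_def y_def sum_squares_eq_zero_iff)
  have Y: "T (T Y) = k *\<^sub>R v"
    by (simp add: TT) (simp add: Y_def k_def axis_def)
  have "k *\<^sub>R J v = J (T (T Y))"
    by (simp add: Y linear_cmul[OF linJ])
  also have "\<dots> = T (T (J Y))" by (simp add: TJ)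
  also have "\<dots> = (x * J Y $ 2 - y * J Y $ 1) *\<^sub>R v" by (rule TT)
  finally have "(1 / k) *\<^sub>R (k *\<^sub>R J v) = (1 / k) *\<^sub>R ((x * J Y $ 2 - y * J Y $ 1) *\<^sub>R v)"
    by simp
  then have "J v = ((x * J Y $ 2 - y * J Y $ 1) / k) *\<^sub>R v"
    using k by simp
  then have "v = 0" using no_real_eigenvector linJ JJ by blast
  then have "v $ 5 = 0" "v $ 6 = 0" by simp_all
  then show False using ne by (simp add: v_def x_def y_def axis_def)
qed

text \<open>Otherwise \<open>c\<close> is a bracket [J c, Y], hence J c = [J c, J Y]. But J c has no
  x1 and x2 components by \<open>J_center_12\<close>, so its brackets are central and J c itself
  would be central.\<close>

lemma J_center:
  assumes c: "c$1 = 0" "c$2 = 0" "c$3 = 0" "c$4 = 0"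
  shows "J c $ 1 = 0 \<and> J c $ 2 = 0 \<and> J c $ 3 = 0 \<and> J c $ 4 = 0"
proof (rule ccontr)
  assume "\<not> ?thesis"
  with J_center_12[OF c] have ne: "J c $ 3 \<noteq> 0 \<or> J c $ 4 \<noteq> 0" by simp
  define x y where "x = J c $ 3" and "y = J c $ 4"
  have xy: "x * x + y * y \<noteq> 0"
    using ne by (simp add: x_def y_def sum_squares_eq_zero_iff)
  \<comment> \<open>The bracket with \<open>J c\<close> maps onto the center, and commutes with \<open>J\<close>.\<close>
  define Y :: "real ^ 6" where
    "Y = (- (x * c$5 + y * c$6) / (x * x + y * y)) *\<^sub>R axis 1 1 +
         ((x * c$6 - y * c$5) / (x * x + y * y)) *\<^sub>R axis 2 1"
  have "M10_bracket (J c) Y = c"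
    using c J_center_12[OF c] xy
    by (simp add: vec_eq_iff forall_6 M10_bracket_nth Y_def axis_def
        flip: x_def y_def) (simp add: divide_simps, algebra)
  then have "J c = M10_bracket (J c) (J Y)"
    using ad_commute[OF central[OF c]] by simp
  then have "J c $ 3 = 0" "J c $ 4 = 0"
    using J_center_12[OF c] by (metis M10_bracket_nth(3) diff_zero mult_zero_left, metis M10_bracket_nth(4))
  with ne show False by simp
qed

text \<open>Work modulo the center, which \<open>J\<close> preserves by \<open>J_center\<close>. If
  J c had a nonzero part in the plane of x1 and x2, a suitable bracket [J c, Y] would be a nonzero
  multiple of x3, while [c, Y] and [c, J Y] are central. The Nijenhuis condition then makes x3 a
  real eigenvector of \<open>J\<close> modulo the center, contradicting that the square of
  \<open>J\<close> is -1.\<close>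

lemma J_34:
  assumes c: "c$1 = 0" "c$2 = 0"
  shows "J c $ 1 = 0 \<and> J c $ 2 = 0"
proof (rule ccontr)
  assume ne: "\<not> ?thesis"
  define x y where "x = J c $ 1" and "y = J c $ 2"
  define k where "k = x * x + y * y"
  have k: "k \<noteq> 0"
    using ne by (simp add: k_def x_def y_def sum_squares_eq_zero_iff)
  define Y :: "real ^ 6" where "Y = x *\<^sub>R axis 2 1 - y *\<^sub>R axis 1 1"
  define e :: "real ^ 6" where "e = axis 3 1"
  define t where "t = x * J Y $ 2 - y * J Y $ 1"
  \<comment> \<open>The central remainder of [J c, Y].\<close>
  define R where "R = M10_bracket (J c) Y - k *\<^sub>R e"
  have R: "R$1 = 0" "R$2 = 0" "R$3 = 0" "R$4 = 0"
    by (simp_all add: R_def M10_bracket_nth k_def e_def Y_def x_def y_def axis_def)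
  define J3 where "J3 = J e"
  have "M10_bracket (J c) Y = R + k *\<^sub>R e" by (simp add: R_def)
  then have "nijenhuis J c Y = M10_bracket (J c) (J Y) - M10_bracket c Y - J R
      - k *\<^sub>R J3 - J (M10_bracket c (J Y))"
    by (simp add: nijenhuis_def linear_add[OF linJ] linear_cmul[OF linJ] J3_def)
  then have eq: "M10_bracket (J c) (J Y) - M10_bracket c Y - J R
      - k *\<^sub>R J3 - J (M10_bracket c (J Y)) = 0" using NJ by simp
  have cJY: "J (M10_bracket c (J Y)) $ i = 0" if "i \<in> {1,2,3,4}" for i
    using J_center[of "M10_bracket c (J Y)"] c that by (auto simp: M10_bracket_nth)
  have JR: "J R $ i = 0" if "i \<in> {1,2,3,4}" for i
    using J_center[OF R] that by auto
  have "k * J3 $ 1 = 0" "k * J3 $ 2 = 0" "k * J3 $ 3 = t" "k * J3 $ 4 = 0"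
    using arg_cong[OF eq, of "\<lambda>v. v$1"] arg_cong[OF eq, of "\<lambda>v. v$2"]
      arg_cong[OF eq, of "\<lambda>v. v$3"] arg_cong[OF eq, of "\<lambda>v. v$4"]
    by (simp_all add: cJY JR M10_bracket_nth c t_def x_def y_def)
  then have J3: "J3 $ 1 = 0" "J3 $ 2 = 0" "J3 $ 3 = t / k" "J3 $ 4 = 0"
    using k by (simp_all add: field_simps)
  \<comment> \<open>Again a central remainder; applying \<open>J\<close> once more shows that the
    eigenvalue t / k would have square -1.\<close>
  define s where "s = J3 - (t / k) *\<^sub>R e"
  have s: "J s $ 3 = 0"
    using J_center[of s] J3 by (simp add: s_def e_def axis_def)
  have "J J3 = (t / k) *\<^sub>R J3 + J s"
    by (simp add: s_def J3_def linear_diff[OF linJ] linear_cmul[OF linJ])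
  then have "J J3 $ 3 = (t / k) * (t / k)"
    using J3 s by simp
  moreover have "J J3 $ 3 = -1"
    by (simp add: J3_def JJ e_def axis_def)
  ultimately show False using zero_le_square[of "t/k"] by linarith
qed

end

text \<open>The square is prescribed only on x1, x3 and x5, because together with their images under
  \<open>J\<close> these vectors span the whole space. This is the form in which the even columns
  can be solved for.\<close>

definition triangular :: "(real ^ 6 \<Rightarrow> real ^ 6) \<Rightarrow> bool" where
  "triangular J \<longleftrightarrow>
     J (axis 3 1) $ 1 = 0 \<and> J (axis 3 1) $ 2 = 0 \<and> J (axis 4 1) $ 1 = 0 \<and> J (axis 4 1) $ 2 = 0 \<and>
     J (axis 5 1) $ 1 = 0 \<and> J (axis 5 1) $ 2 = 0 \<and> J (axis 5 1) $ 3 = 0 \<and> J (axis 5 1) $ 4 = 0 \<and>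
     J (axis 6 1) $ 1 = 0 \<and> J (axis 6 1) $ 2 = 0 \<and> J (axis 6 1) $ 3 = 0 \<and> J (axis 6 1) $ 4 = 0 \<and>
     J (J (axis 1 1)) = - axis 1 1 \<and> J (J (axis 3 1)) = - axis 3 1 \<and> J (J (axis 5 1)) = - axis 5 1"

section \<open>Propagation of identities from x1, x3, x5 to the whole algebra\<close>

context
  fixes J :: "real ^ 6 \<Rightarrow> real ^ 6"
  assumes lin: "linear J" and tri: "triangular J"
begin

text \<open>By triangularity the first diagonal entry of the square involves only its own 2 x 2
  block. If the off-diagonal entry vanished, -1 would be the square of a real number.\<close>

lemma tri_nz: "J (axis 1 1) $ 2 \<noteq> 0" "J (axis 3 1) $ 4 \<noteq> 0" "J (axis 5 1) $ 6 \<noteq> 0"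
proof -
  have sq: "t * t \<noteq> - 1" for t :: real using zero_le_square[of t] by linarith
  have "J (J (axis 1 1)) $ 1 = - 1" "J (J (axis 3 1)) $ 3 = - 1" "J (J (axis 5 1)) $ 5 = - 1"
    using tri by (simp_all add: triangular_def axis_def)
  then show "J (axis 1 1) $ 2 \<noteq> 0" "J (axis 3 1) $ 4 \<noteq> 0" "J (axis 5 1) $ 6 \<noteq> 0"
    using tri sq by (auto simp: triangular_def linear_expand6[OF lin, of "J _"])
qed

text \<open>Working upwards from the center, J x5 yields x6, then J x3 yields x4 and J x1 yields x2,
  after division by the entries in \<open>tri_nz\<close>. Any linear condition stable under
  \<open>J\<close> thus needs checking only at x1, x3, x5.\<close>

lemma invariant_subspace_UNIV:
  assumes S: "subspace S" "\<And>X. X \<in> S \<Longrightarrow> J X \<in> S" "axis 1 1 \<in> S" "axis 3 1 \<in> S" "axis 5 1 \<in> S"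
  shows "X \<in> S"
proof -
  have solve: "b \<in> S" if "r \<noteq> 0" "r *\<^sub>R b \<in> S" for r b
    using subspace_scale[OF S(1) that(2), of "inverse r"] that(1) by simp
  note sub = subspace_add[OF S(1)] subspace_diff[OF S(1)] subspace_scale[OF S(1)]
  have "J (axis 5 1) $ 6 *\<^sub>R axis 6 1 = J (axis 5 1) - J (axis 5 1) $ 5 *\<^sub>R axis 5 1"
    using tri by (simp add: vec_eq_iff forall_6 axis_def triangular_def)
  then have "J (axis 5 1) $ 6 *\<^sub>R axis 6 1 \<in> S" by (simp only:) (intro sub S)
  then have 6: "axis 6 1 \<in> S" using solve tri_nz by blast
  have "J (axis 3 1) $ 4 *\<^sub>R axis 4 1 = J (axis 3 1) - J (axis 3 1) $ 3 *\<^sub>R axis 3 1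
      - J (axis 3 1) $ 5 *\<^sub>R axis 5 1 - J (axis 3 1) $ 6 *\<^sub>R axis 6 1"
    using tri by (simp add: vec_eq_iff forall_6 axis_def triangular_def)
  then have "J (axis 3 1) $ 4 *\<^sub>R axis 4 1 \<in> S" by (simp only:) (intro sub S 6)
  then have 4: "axis 4 1 \<in> S" using solve tri_nz by blast
  have "J (axis 1 1) $ 2 *\<^sub>R axis 2 1 = J (axis 1 1) - J (axis 1 1) $ 1 *\<^sub>R axis 1 1
      - J (axis 1 1) $ 3 *\<^sub>R axis 3 1 - J (axis 1 1) $ 4 *\<^sub>R axis 4 1
      - J (axis 1 1) $ 5 *\<^sub>R axis 5 1 - J (axis 1 1) $ 6 *\<^sub>R axis 6 1"
    by (simp add: vec_eq_iff forall_6 axis_def)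
  then have "J (axis 1 1) $ 2 *\<^sub>R axis 2 1 \<in> S" by (simp only:) (intro sub S 4 6)
  then have 2: "axis 2 1 \<in> S" using solve tri_nz by blast
  show ?thesis
    by (subst vec6_expand[of X]) (intro sub S 2 4 6)
qed

lemma tri_JJ: "J (J X) = - X"
proof -
  have "X \<in> {X. J (J X) = - X}"
    by (rule invariant_subspace_UNIV)
      (use tri in \<open>auto simp: triangular_def subspace_def linear_0[OF lin] linear_add[OF lin]
        linear_cmul[OF lin] linear_neg[OF lin]\<close>)
  then show ?thesis by simp
qed

lemma nijenhuis_bilinear: "bilinear (nijenhuis J)"
proof -
  note br = bilinear_ladd[OF bilinear_M10_bracket] bilinear_radd[OF bilinear_M10_bracket]
    bilinear_lmul[OF bilinear_M10_bracket] bilinear_rmul[OF bilinear_M10_bracket]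
  show ?thesis
    by (simp add: bilinear_def linear_iff nijenhuis_def linear_add[OF lin] linear_cmul[OF lin] br
        scaleR_diff_right)
qed

lemma M10_bracket_skew: "M10_bracket Y X = - M10_bracket X Y"
  by (simp add: vec_eq_iff forall_6 M10_bracket_nth)

lemma nijenhuis_skew: "nijenhuis J Y X = - nijenhuis J X Y"
  unfolding nijenhuis_def M10_bracket_skew[of Y X] M10_bracket_skew[of "J Y" X]
    M10_bracket_skew[of Y "J X"] M10_bracket_skew[of "J Y" "J X"]
  by (simp add: linear_neg[OF lin])

text \<open>This makes the annihilator of each \<open>Y\<close> a \<open>J\<close>-invariant
  subspace, as \<open>invariant_subspace_UNIV\<close> requires.\<close>

lemma nijenhuis_J: "nijenhuis J (J X) Y = - J (nijenhuis J X Y)"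
  unfolding nijenhuis_def
  by (simp add: tri_JJ linear_diff[OF lin] linear_neg[OF lin] bilinear_lneg[OF bilinear_M10_bracket])

text \<open>Invariance in each argument leaves the pairs among x1, x3, x5. Skew symmetry disposes of
  equal arguments, and pairs with x5 vanish because x5 and J x5 are central; only (x1, x3)
  remains.\<close>

lemma nijenhuis_zero:
  assumes "nijenhuis J (axis 1 1) (axis 3 1) = 0"
  shows "nijenhuis J X Y = 0"
proof -
  have left: "nijenhuis J X Y = 0"
    if "nijenhuis J (axis 1 1) Y = 0" "nijenhuis J (axis 3 1) Y = 0" "nijenhuis J (axis 5 1) Y = 0"
    for X Y
  proof -
    have "X \<in> {X. nijenhuis J X Y = 0}"
      by (rule invariant_subspace_UNIV)
        (use that in \<open>auto simp: subspace_def nijenhuis_J linear_0[OF lin]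
          bilinear_ladd[OF nijenhuis_bilinear] bilinear_lmul[OF nijenhuis_bilinear]
          bilinear_lzero[OF nijenhuis_bilinear]\<close>)
    then show ?thesis by simp
  qed
  have self: "nijenhuis J X X = 0" for X
    using nijenhuis_skew[of X X] by (simp add: vec_eq_iff)
  have 15: "nijenhuis J Y (axis 5 1) = 0" if "Y \<in> {axis 1 1, axis 3 1}" for Y
  proof -
    have "M10_bracket X (axis 5 1) = 0" "M10_bracket X (J (axis 5 1)) = 0" for X
      using tri by (auto simp: triangular_def vec_eq_iff forall_6 M10_bracket_nth axis_def)
    then show ?thesis by (simp add: nijenhuis_def linear_0[OF lin])
  qed
  note skew = nijenhuis_skew[of "axis 3 1" "axis 1 1"] nijenhuis_skew[of "axis 5 1" "axis 1 1"]
    nijenhuis_skew[of "axis 5 1" "axis 3 1"]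
  \<comment> \<open>First the left argument becomes arbitrary; swapping the arguments and using
    \<open>left\<close> again then frees the other one.\<close>
  have right: "nijenhuis J Z (axis 1 1) = 0" "nijenhuis J Z (axis 3 1) = 0"
    "nijenhuis J Z (axis 5 1) = 0" for Z
    by (rule left; simp add: skew assms self 15)+
  show ?thesis
    by (rule left; subst nijenhuis_skew; simp add: right)
qed

end

lemma complex_structure_char:
  assumes "linear J"
  shows "complex_structure M10_bracket J \<longleftrightarrow>
    triangular J \<and> nijenhuis J (axis 1 1) (axis 3 1) = 0"
proof
  assume cs: "complex_structure M10_bracket J"
  then show "triangular J \<and> nijenhuis J (axis 1 1) (axis 3 1) = 0"
    using J_34[OF cs, of "axis 3 1"] J_34[OF cs, of "axis 4 1"]
      J_center[OF cs, of "axis 5 1"] J_center[OF cs, of "axis 6 1"]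
    by (simp add: triangular_def complex_structure_iff axis_def)
next
  assume "triangular J \<and> nijenhuis J (axis 1 1) (axis 3 1) = 0"
  then show "complex_structure M10_bracket J"
    using assms tri_JJ nijenhuis_zero by (auto simp: complex_structure_iff)
qed

section \<open>Matrices of the complex structures\<close>

definition vec6 :: "real \<Rightarrow> real \<Rightarrow> real \<Rightarrow> real \<Rightarrow> real \<Rightarrow> real \<Rightarrow> real ^ 6" where
  "vec6 a b c d e f = a *\<^sub>R axis 1 1 + b *\<^sub>R axis 2 1 + c *\<^sub>R axis 3 1
     + d *\<^sub>R axis 4 1 + e *\<^sub>R axis 5 1 + f *\<^sub>R axis 6 1"

lemma vec6_nth [simp]:
  "vec6 a b c d e f $ 1 = a" "vec6 a b c d e f $ 2 = b" "vec6 a b c d e f $ 3 = c"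
  "vec6 a b c d e f $ 4 = d" "vec6 a b c d e f $ 5 = e" "vec6 a b c d e f $ 6 = f"
  by (simp_all add: vec6_def axis_def)

definition matrix_of_columns :: "real ^ 6 \<Rightarrow> real ^ 6 \<Rightarrow> real ^ 6 \<Rightarrow> real ^ 6 \<Rightarrow> real ^ 6 \<Rightarrow> real ^ 6 \<Rightarrow> real ^ 6 ^ 6"
  where "matrix_of_columns c1 c2 c3 c4 c5 c6 = (\<chi> i j. (if j = 1 then c1 else if j = 2 then c2
    else if j = 3 then c3 else if j = 4 then c4 else if j = 5 then c5 else c6) $ i)"

lemma matrix_of_columns_nth [simp]:
  "matrix_of_columns c1 c2 c3 c4 c5 c6 $ i $ 1 = c1 $ i"
  "matrix_of_columns c1 c2 c3 c4 c5 c6 $ i $ 2 = c2 $ i"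
  "matrix_of_columns c1 c2 c3 c4 c5 c6 $ i $ 3 = c3 $ i"
  "matrix_of_columns c1 c2 c3 c4 c5 c6 $ i $ 4 = c4 $ i"
  "matrix_of_columns c1 c2 c3 c4 c5 c6 $ i $ 5 = c5 $ i"
  "matrix_of_columns c1 c2 c3 c4 c5 c6 $ i $ 6 = c6 $ i"
  by (simp_all add: matrix_of_columns_def)

lemma axis_image_nth: "(A *v axis j 1) $ i = (A :: real ^ 6 ^ 6) $ i $ j"
  by (simp add: matrix_vector_mult_basis column_def)

lemma eq_matrix_of_columns_iff:
  "A = matrix_of_columns c1 c2 c3 c4 c5 c6 \<longleftrightarrow>
    A *v axis 1 1 = c1 \<and> A *v axis 2 1 = c2 \<and> A *v axis 3 1 = c3 \<and>
    A *v axis 4 1 = c4 \<and> A *v axis 5 1 = c5 \<and> A *v axis 6 1 = c6"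
  by (auto simp: vec_eq_iff forall_6 axis_image_nth)

lemma linear_6_columns:
  fixes A :: "real ^ 6 ^ 6"
  shows "A *v X = X$1 *\<^sub>R (A *v axis 1 1) + X$2 *\<^sub>R (A *v axis 2 1) + X$3 *\<^sub>R (A *v axis 3 1)
     + X$4 *\<^sub>R (A *v axis 4 1) + X$5 *\<^sub>R (A *v axis 5 1) + X$6 *\<^sub>R (A *v axis 6 1)"
  by (rule linear_expand6) (rule matrix_vector_mul_linear)

text \<open>
  The even columns are forced by the odd ones, because the square is \<open>- 1\<close> on \<open>x\<^sub>1\<close>, \<open>x\<^sub>3\<close>, \<open>x\<^sub>5\<close>.
\<close>

definition J_of :: "real \<Rightarrow> real \<Rightarrow> real \<Rightarrow> real \<Rightarrow> real \<Rightarrow> real \<Rightarrow>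
    real \<Rightarrow> real \<Rightarrow> real \<Rightarrow> real \<Rightarrow> real \<Rightarrow> real \<Rightarrow> real ^ 6 ^ 6" where
  "J_of p q r s f g b1 b2 d1 d2 e1 e2 =
    (let c1 = vec6 p q b1 b2 d1 d2; c3 = vec6 0 0 r s e1 e2; c5 = vec6 0 0 0 0 f g;
         c6 = (- 1 / g) *\<^sub>R (axis 5 1 + f *\<^sub>R c5);
         c4 = (- 1 / s) *\<^sub>R (axis 3 1 + r *\<^sub>R c3 + e1 *\<^sub>R c5 + e2 *\<^sub>R c6);
         c2 = (- 1 / q) *\<^sub>R (axis 1 1 + p *\<^sub>R c1 + b1 *\<^sub>R c3 + b2 *\<^sub>R c4 + d1 *\<^sub>R c5 + d2 *\<^sub>R c6)
     in matrix_of_columns c1 c2 c3 c4 c5 c6)"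

text \<open>Here \<open>x\<close> will be an even column, \<open>t\<close> the nonzero entry
  multiplying it, and \<open>y\<close> the contribution of the other columns.\<close>

lemma solve_scaled:
  fixes x y z :: "'a::real_vector"
  assumes "t \<noteq> 0"
  shows "y + t *\<^sub>R x = - z \<longleftrightarrow> x = (- 1 / t) *\<^sub>R (z + y)"
proof
  assume "y + t *\<^sub>R x = - z"
  then have "t *\<^sub>R x = - z - y" by (metis add_diff_cancel_left')
  then have "t *\<^sub>R x = - (z + y)" by simp
  then have "inverse t *\<^sub>R (t *\<^sub>R x) = inverse t *\<^sub>R (- (z + y))" by simp
  then show "x = (- 1 / t) *\<^sub>R (z + y)" using assms by (simp add: divide_inverse algebra_simps)
next
  assume "x = (- 1 / t) *\<^sub>R (z + y)"
  then have "t *\<^sub>R x = - (z + y)" using assms by simp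
  then show "y + t *\<^sub>R x = - z" by simp
qed

text \<open>Applying the matrix to its own first column gives a combination of the columns in which
  the second one has coefficient A$2$1. So the square condition at x1 amounts to a formula for the
  second column, and likewise at x3 and x5 for the fourth and sixth.\<close>

lemma triangular_iff_J_of:
  fixes A :: "real ^ 6 ^ 6"
  shows "triangular ((*v) A) \<longleftrightarrow> A$2$1 \<noteq> 0 \<and> A$4$3 \<noteq> 0 \<and> A$6$5 \<noteq> 0 \<and>
    A = J_of (A$1$1) (A$2$1) (A$3$3) (A$4$3) (A$5$5) (A$6$5)
      (A$3$1) (A$4$1) (A$5$1) (A$6$1) (A$5$3) (A$6$3)"
    (is "?L \<longleftrightarrow> ?nz1 \<and> ?nz2 \<and> ?nz3 \<and> A = ?J")
proof -
  let ?a = "\<lambda>j. A *v axis j 1"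
  have nz: "?nz1 \<and> ?nz2 \<and> ?nz3" if ?L
    using tri_nz[OF matrix_vector_mul_linear that] by (simp add: axis_image_nth)
  have sq1: "A *v (?a 1) = - axis 1 1 \<longleftrightarrow> ?a 2 = (- 1 / A$2$1) *\<^sub>R (axis 1 1 + (A$1$1 *\<^sub>R ?a 1 +
       A$3$1 *\<^sub>R ?a 3 + A$4$1 *\<^sub>R ?a 4 + A$5$1 *\<^sub>R ?a 5 + A$6$1 *\<^sub>R ?a 6))" if ?nz1
    by (subst solve_scaled[OF that, symmetric], subst linear_6_columns)
      (simp add: axis_image_nth algebra_simps)
  have sq3: "A *v (?a 3) = - axis 3 1 \<longleftrightarrow> ?a 4 = (- 1 / A$4$3) *\<^sub>R (axis 3 1 + (A$3$3 *\<^sub>R ?a 3 +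
       A$5$3 *\<^sub>R ?a 5 + A$6$3 *\<^sub>R ?a 6))" if ?nz2 "A$1$3 = 0" "A$2$3 = 0"
    by (subst solve_scaled[OF that(1), symmetric], subst linear_6_columns)
      (simp add: axis_image_nth that algebra_simps)
  have sq5: "A *v (?a 5) = - axis 5 1 \<longleftrightarrow> ?a 6 = (- 1 / A$6$5) *\<^sub>R (axis 5 1 + A$5$5 *\<^sub>R ?a 5)"
    if ?nz3 "A$1$5 = 0" "A$2$5 = 0" "A$3$5 = 0" "A$4$5 = 0"
    by (subst solve_scaled[OF that(1), symmetric], subst linear_6_columns)
      (simp add: axis_image_nth that algebra_simps)
  define c1 c3 c5 where "c1 = vec6 (A$1$1) (A$2$1) (A$3$1) (A$4$1) (A$5$1) (A$6$1)"
    and "c3 = vec6 0 0 (A$3$3) (A$4$3) (A$5$3) (A$6$3)"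
    and "c5 = vec6 0 0 0 0 (A$5$5) (A$6$5)"
  define c6 where "c6 = (- 1 / A$6$5) *\<^sub>R (axis 5 1 + A$5$5 *\<^sub>R c5)"
  define c4 where "c4 = (- 1 / A$4$3) *\<^sub>R (axis 3 1 + A$3$3 *\<^sub>R c3 + A$5$3 *\<^sub>R c5 + A$6$3 *\<^sub>R c6)"
  define c2 where "c2 = (- 1 / A$2$1) *\<^sub>R (axis 1 1 + A$1$1 *\<^sub>R c1 + A$3$1 *\<^sub>R c3 + A$4$1 *\<^sub>R c4
    + A$5$1 *\<^sub>R c5 + A$6$1 *\<^sub>R c6)"
  have J: "?J = matrix_of_columns c1 c2 c3 c4 c5 c6"
    by (simp add: J_of_def Let_def c1_def c2_def c3_def c4_def c5_def c6_def)
  have a1: "?a 1 = c1"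
    by (simp add: vec_eq_iff forall_6 axis_image_nth c1_def)
  have a3: "?a 3 = c3 \<longleftrightarrow> A$1$3 = 0 \<and> A$2$3 = 0"
    by (simp add: vec_eq_iff forall_6 axis_image_nth c3_def)
  have a5: "?a 5 = c5 \<longleftrightarrow> A$1$5 = 0 \<and> A$2$5 = 0 \<and> A$3$5 = 0 \<and> A$4$5 = 0"
    by (simp add: vec_eq_iff forall_6 axis_image_nth c5_def)
  have c6: "c6$1 = 0" "c6$2 = 0" "c6$3 = 0" "c6$4 = 0"
    by (simp_all add: c6_def c5_def axis_def)
  have c4: "c4$1 = 0" "c4$2 = 0"
    by (simp_all add: c4_def c3_def c5_def c6 axis_def)
  have "?L \<longleftrightarrow> A = ?J" if nz: ?nz1 ?nz2 ?nz3
  proof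
    assume ?L
    then have z: "A$1$3 = 0" "A$2$3 = 0" "A$1$5 = 0" "A$2$5 = 0" "A$3$5 = 0" "A$4$5 = 0"
      and sq: "A *v (?a 1) = - axis 1 1" "A *v (?a 3) = - axis 3 1" "A *v (?a 5) = - axis 5 1"
      by (simp_all add: triangular_def axis_image_nth)
    \<comment> \<open>The even columns are identified in the order 6, 4, 2, since each formula
      refers to the ones already found.\<close>
    have 3: "?a 3 = c3" and 5: "?a 5 = c5" using a3 a5 z by auto
    have 6: "?a 6 = c6" using sq5 nz z sq unfolding c6_def 5 by simp
    have 4: "?a 4 = c4" using sq3 nz z sq unfolding c4_def 3 5 6 by (simp add: add.assoc)
    have 2: "?a 2 = c2" using sq1 nz z sq unfolding c2_def a1 3 4 5 6 by (simp add: add.assoc)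
    show "A = ?J" unfolding J eq_matrix_of_columns_iff using a1 2 3 4 5 6 by simp
  next
    assume "A = ?J"
    then have cols: "?a 2 = c2" "?a 3 = c3" "?a 4 = c4" "?a 5 = c5" "?a 6 = c6"
      unfolding J eq_matrix_of_columns_iff by simp_all
    have z: "A$1$3 = 0" "A$2$3 = 0" "A$1$5 = 0" "A$2$5 = 0" "A$3$5 = 0" "A$4$5 = 0"
      using a3 a5 cols by auto
    have "A$1$4 = 0" "A$2$4 = 0" "A$1$6 = 0" "A$2$6 = 0" "A$3$6 = 0" "A$4$6 = 0"
      using cols c4 c6 by (metis axis_image_nth)+
    moreover have "A *v (?a 5) = - axis 5 1"
      using sq5 nz z unfolding cols c6_def by simp
    moreover have "A *v (?a 3) = - axis 3 1"
      using sq3 nz z unfolding cols c4_def by (simp add: add.assoc)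
    moreover have "A *v (?a 1) = - axis 1 1"
      using sq1 nz z unfolding a1 cols c2_def by (simp add: add.assoc)
    ultimately show ?L using z by (simp add: triangular_def axis_image_nth)
  qed
  then show ?thesis using nz by blast
qed

text \<open>
  With \<open>a = p - i q\<close>, \<open>c = r + i s\<close> and \<open>F\<close> the action of \<open>J\<close> on the center, these are the two
  coordinates of \<open>F (a + c) = a c - 1\<close>. They are affine in each of the pairs \<open>(f, g)\<close>, \<open>(r, s)\<close>
  and \<open>(p, q)\<close>.
\<close>

definition center_eq :: "real \<Rightarrow> real \<Rightarrow> real \<Rightarrow> real \<Rightarrow> real \<Rightarrow> real \<Rightarrow> bool" where
  "center_eq p q r s f g \<longleftrightarrow>
     f * (p * s - q * r) - g * (p * r + q * s - 1) = s - q \<and>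
     (p + r) * g - (s - q) * f = p * s - q * r"

text \<open>All brackets occurring here are central, so only the diagonal blocks enter. The two
  central coordinates are computed, the first is cleared of the denominator g, and the second is
  then used to simplify it.\<close>

lemma nijenhuis_13_iff:
  fixes A :: "real ^ 6 ^ 6"
  assumes tri: "triangular ((*v) A)"
  shows "nijenhuis ((*v) A) (axis 1 1) (axis 3 1) = 0 \<longleftrightarrow>
    center_eq (A$1$1) (A$2$1) (A$3$3) (A$4$3) (A$5$5) (A$6$5)"
proof -
  define p q r s f g where "p = A$1$1" and "q = A$2$1" and "r = A$3$3" and "s = A$4$3"
    and "f = A$5$5" and "g = A$6$5"
  note defs = p_def q_def r_def s_def f_def g_def
  have g: "g \<noteq> 0"
    using tri triangular_iff_J_of by (simp add: defs)
  have z: "A$1$3 = 0" "A$2$3 = 0" "A$1$5 = 0" "A$2$5 = 0" "A$3$5 = 0" "A$4$5 = 0"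
    "A$1$6 = 0" "A$2$6 = 0" "A$3$6 = 0" "A$4$6 = 0"
    and sq: "A *v (A *v axis 5 1) = - axis 5 1"
    using tri by (simp_all add: triangular_def axis_image_nth)
  \<comment> \<open>The square condition at x5 expresses the second column of the central block
    through f and g.\<close>
  have "f * f + g * A$5$6 = - 1" "f * g + g * A$6$6 = 0"
    using arg_cong[OF sq, of "\<lambda>v. v$5"] arg_cong[OF sq, of "\<lambda>v. v$6"]
    by (simp_all add: linear_6_columns[of A "A *v _"] axis_image_nth z flip: defs)
      (simp_all add: axis_def)
  then have "g * A$5$6 = - (1 + f * f)" and *: "g * A$6$6 = g * - f"
    by (simp_all add: algebra_simps)
  then have F: "A$5$6 = - (1 + f * f) / g" "A$6$6 = - f"
    using g by (simp add: field_simps) (use * g mult_left_cancel in blast)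
  define B1 B2 B3 where "B1 = M10_bracket (A *v axis 1 1) (A *v axis 3 1)"
    and "B2 = M10_bracket (A *v axis 1 1) (axis 3 1)" and "B3 = M10_bracket (axis 1 1) (A *v axis 3 1)"
  have B1: "B1 = vec6 0 0 0 0 (p * r + q * s) (p * s - q * r)"
    by (simp add: B1_def vec_eq_iff forall_6 M10_bracket_nth axis_image_nth z defs)
  have B2: "B2 = vec6 0 0 0 0 p (- q)"
    by (simp add: B2_def vec_eq_iff forall_6 M10_bracket_nth axis_image_nth z defs) (simp add: axis_def)
  have B3: "B3 = vec6 0 0 0 0 r s"
    by (simp add: B3_def vec_eq_iff forall_6 M10_bracket_nth axis_image_nth z defs) (simp add: axis_def)
  have B0: "M10_bracket (axis 1 1) (axis 3 1) = axis 5 1"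
    by (simp add: vec_eq_iff forall_6 M10_bracket_nth axis_def)
  have "nijenhuis ((*v) A) (axis 1 1) (axis 3 1) = B1 - axis 5 1 - A *v B2 - A *v B3"
    by (simp add: nijenhuis_def B1_def B2_def B3_def B0)
  also have "\<dots> = vec6 0 0 0 0
      (p * r + q * s - 1 - (p * f + q * (1 + f * f) / g) - (r * f - s * (1 + f * f) / g))
      (p * s - q * r - (p * g + q * f) - (r * g - s * f))"
    unfolding B1 B2 B3 linear_6_columns[of A "vec6 _ _ _ _ _ _"]
    by (simp add: vec_eq_iff forall_6 axis_image_nth z F flip: defs) (use g in \<open>simp add: axis_def field_simps\<close>)
  finally have "nijenhuis ((*v) A) (axis 1 1) (axis 3 1) = 0 \<longleftrightarrow>
      p * r + q * s - 1 - (p * f + q * (1 + f * f) / g) - (r * f - s * (1 + f * f) / g) = 0 \<and>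
      p * s - q * r - (p * g + q * f) - (r * g - s * f) = 0"
    by (simp add: vec_eq_iff forall_6)
  also have "\<dots> \<longleftrightarrow> (p * r + q * s - 1) * g = (p + r) * f * g - (s - q) * (1 + f * f) \<and>
      (p + r) * g - (s - q) * f = p * s - q * r"
  proof -
    have "p * r + q * s - 1 - (p * f + q * (1 + f * f) / g) - (r * f - s * (1 + f * f) / g) =
        ((p * r + q * s - 1) * g - ((p + r) * f * g - (s - q) * (1 + f * f))) / g"
      using g by (simp add: field_simps)
    moreover have "p * s - q * r - (p * g + q * f) - (r * g - s * f) =
        p * s - q * r - ((p + r) * g - (s - q) * f)"
      by (simp add: algebra_simps)
    ultimately show ?thesis using g by auto
  qed
  also have "\<dots> \<longleftrightarrow> center_eq p q r s f g"
  proof -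
    \<comment> \<open>Substituting f times the second equation removes the term in f * f, which
      leaves an equation affine in (f, g).\<close>
    have "(p * r + q * s - 1) * g = (p + r) * f * g - (s - q) * (1 + f * f) \<longleftrightarrow>
        f * (p * s - q * r) - g * (p * r + q * s - 1) = s - q"
      if "(p + r) * g - (s - q) * f = p * s - q * r"
      unfolding that[symmetric] by (auto simp: algebra_simps)
    then show ?thesis unfolding center_eq_def by blast
  qed
  finally show ?thesis by (simp add: defs)
qed

text \<open>Twelve entries of the odd columns determine the matrix and are subject to the two
  equations of \<open>center_eq\<close>; this accounts for the dimension 12 - 2 = 10.\<close>

lemma X_M10_iff:
  "A \<in> X_M10 \<longleftrightarrow> A$2$1 \<noteq> 0 \<and> A$4$3 \<noteq> 0 \<and> A$6$5 \<noteq> 0 \<and>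
    A = J_of (A$1$1) (A$2$1) (A$3$3) (A$4$3) (A$5$5) (A$6$5)
      (A$3$1) (A$4$1) (A$5$1) (A$6$1) (A$5$3) (A$6$3) \<and>
    center_eq (A$1$1) (A$2$1) (A$3$3) (A$4$3) (A$5$5) (A$6$5)"
proof -
  have "A \<in> X_M10 \<longleftrightarrow> complex_structure M10_bracket ((*v) A)"
  proof
    assume "A \<in> X_M10"
    then obtain J where "A = matrix J" "complex_structure M10_bracket J" by (auto simp: X_M10_def)
    moreover from this have "(*v) A = J"
      by (simp add: fun_eq_iff complex_structure_def matrix_works)
    ultimately show "complex_structure M10_bracket ((*v) A)" by simp
  next
    assume "complex_structure M10_bracket ((*v) A)"
    then show "A \<in> X_M10" unfolding X_M10_def
      by (intro image_eqI[of _ _ "(*v) A"]) (simp_all add: matrix_of_matrix_vector_mul)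
  qed
  then show ?thesis
    using complex_structure_char[OF matrix_vector_mul_linear, of A] nijenhuis_13_iff[of A]
      triangular_iff_J_of[of A] by blast
qed

section \<open>Smoothness of the parametrization \<open>J_of\<close>\<close>

lemma smooth_on_inner_const:
  fixes f :: "'a::euclidean_space \<Rightarrow> 'b::real_inner"
  assumes "open U" "smooth_on U f"
  shows "smooth_on U (\<lambda>x. f x \<bullet> c)"
  using assms by (simp add: smooth_on_def Ck_on_const
      bounded_bilinear.Ck_on_prod[OF bounded_bilinear_inner])

lemma smooth_on_matrix_of_columns:
  fixes c1 c2 c3 c4 c5 c6 :: "'a::euclidean_space \<Rightarrow> real ^ 6"
  assumes "open U" "smooth_on U c1" "smooth_on U c2" "smooth_on U c3" "smooth_on U c4"
    "smooth_on U c5" "smooth_on U c6"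
  shows "smooth_on U (\<lambda>x. matrix_of_columns (c1 x) (c2 x) (c3 x) (c4 x) (c5 x) (c6 x))"
proof (rule smooth_on_matrix[OF assms(1)])
  have comp: "smooth_on U (\<lambda>x. c x $ i)" if "smooth_on U c" for c :: "'a \<Rightarrow> real ^ 6" and i
    using smooth_on_inner_const[OF assms(1) that, of "axis i 1"] by (simp add: inner_axis)
  have "\<forall>j. smooth_on U (\<lambda>x. matrix_of_columns (c1 x) (c2 x) (c3 x) (c4 x) (c5 x) (c6 x) $ i $ j)" for i
    unfolding forall_6 using assms by (simp add: comp)
  then show "smooth_on U (\<lambda>x. matrix_of_columns (c1 x) (c2 x) (c3 x) (c4 x) (c5 x) (c6 x) $ i $ j)"
    for i j by blast
qed

lemma smooth_on_J_of:
  fixes p q r s f g :: "'a::euclidean_space \<Rightarrow> real"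
  assumes U: "open U" and "smooth_on U p" "smooth_on U q" "smooth_on U r" "smooth_on U s"
    "smooth_on U f" "smooth_on U g" "smooth_on U b1" "smooth_on U b2" "smooth_on U d1"
    "smooth_on U d2" "smooth_on U e1" "smooth_on U e2"
    and "\<And>x. x \<in> U \<Longrightarrow> q x \<noteq> 0" "\<And>x. x \<in> U \<Longrightarrow> s x \<noteq> 0" "\<And>x. x \<in> U \<Longrightarrow> g x \<noteq> 0"
  shows "smooth_on U (\<lambda>x. J_of (p x) (q x) (r x) (s x) (f x) (g x)
    (b1 x) (b2 x) (d1 x) (d2 x) (e1 x) (e2 x))"
  unfolding J_of_def Let_def vec6_def
  by (intro smooth_on_matrix_of_columns smooth_on_add smooth_on_scaleR smooth_on_divide
      smooth_on_const assms)

section \<open>Charts\<close>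

lemma cramer_2:
  fixes a b c d u v x y :: "'a::field"
  assumes "a * d - b * c \<noteq> 0"
  shows "a * x + b * y = u \<and> c * x + d * y = v \<longleftrightarrow>
    x = (u * d - b * v) / (a * d - b * c) \<and> y = (a * v - c * u) / (a * d - b * c)"
    (is "?L \<longleftrightarrow> ?R")
proof -
  have "?R \<longleftrightarrow> x * (a * d - b * c) = u * d - b * v \<and> y * (a * d - b * c) = a * v - c * u"
    using assms by (simp add: eq_divide_eq)
  also have "\<dots> \<longleftrightarrow> ?L"
  proof
    assume ?L
    then show "x * (a * d - b * c) = u * d - b * v \<and> y * (a * d - b * c) = a * v - c * u"
      by (auto simp: algebra_simps)
  next
    let ?D = "a * d - b * c"
    assume *: "x * ?D = u * d - b * v \<and> y * ?D = a * v - c * u"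
    have "(a * x + b * y) * ?D = a * (x * ?D) + b * (y * ?D)"
      "(c * x + d * y) * ?D = c * (x * ?D) + d * (y * ?D)"
      by (simp_all add: distrib_right mult.assoc)
    then have "(a * x + b * y) * ?D = u * ?D" "(c * x + d * y) * ?D = v * ?D"
      unfolding *[THEN conjunct1] *[THEN conjunct2] by (simp_all add: algebra_simps)
    then show ?L using assms by simp
  qed
  finally show ?thesis by blast
qed

text \<open>The determinant of \<open>center_eq\<close> as a linear system in (f, g), expanded and
  regrouped; \<open>det_rs\<close> and \<open>det_pq\<close> are its analogues for (r, s) and (p,
  q). The regrouped form makes their joint vanishing easy to exclude.\<close>

definition det_fg :: "real \<Rightarrow> real \<Rightarrow> real \<Rightarrow> real \<Rightarrow> real" where
  "det_fg p q r s = s * (p * p + q * q + 1) - q * (r * r + s * s + 1)"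

definition det_rs :: "real \<Rightarrow> real \<Rightarrow> real \<Rightarrow> real \<Rightarrow> real" where
  "det_rs p q f g = q * (f * f + g * g + 1) + g * (p * p + q * q + 1)"

definition det_pq :: "real \<Rightarrow> real \<Rightarrow> real \<Rightarrow> real \<Rightarrow> real" where
  "det_pq r s f g = s * (f * f + g * g + 1) - g * (r * r + s * s + 1)"

lemma center_eq_solve_fg:
  assumes "det_fg p q r s \<noteq> 0"
  shows "center_eq p q r s f g \<longleftrightarrow>
    f = ((s - q) * (p + r) + (p * r + q * s - 1) * (p * s - q * r)) / det_fg p q r s \<and>
    g = ((p * s - q * r) * (p * s - q * r) + (s - q) * (s - q)) / det_fg p q r s"
proof -
  have D: "(p * s - q * r) * (p + r) - (- (p * r + q * s - 1)) * (- (s - q)) = det_fg p q r s"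
    by (simp add: det_fg_def algebra_simps)
  show ?thesis
    using cramer_2[of "p * s - q * r" "p + r" "- (p * r + q * s - 1)" "- (s - q)" f g "s - q" "p * s - q * r"]
      assms unfolding D center_eq_def by (simp add: algebra_simps)
qed

lemma center_eq_solve_rs:
  assumes "det_rs p q f g \<noteq> 0"
  shows "center_eq p q r s f g \<longleftrightarrow>
    r = ((q + g) * (f + p) + (f * p - g * q - 1) * (p * g + q * f)) / det_rs p q f g \<and>
    s = ((f * q + g * p) * (p * g + q * f) + (g + q) * (q + g)) / det_rs p q f g"
proof -
  have D: "(- (f * q + g * p)) * (- (f + p)) - (f * p - g * q - 1) * (g + q) = det_rs p q f g"
    by (simp add: det_rs_def algebra_simps)
  have "center_eq p q r s f g \<longleftrightarrow>
      (- (f * q + g * p)) * r + (f * p - g * q - 1) * s = - (q + g) \<and>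
      (g + q) * r + (- (f + p)) * s = - (p * g + q * f)"
    unfolding center_eq_def by (auto simp: algebra_simps)
  also have "\<dots> \<longleftrightarrow> r = (- (q + g) * - (f + p) - (f * p - g * q - 1) * - (p * g + q * f)) / det_rs p q f g \<and>
      s = (- (f * q + g * p) * - (p * g + q * f) - (g + q) * - (q + g)) / det_rs p q f g"
    unfolding D[symmetric] by (rule cramer_2) (simp only: D assms not_False_eq_True)
  finally show ?thesis by (simp only: minus_mult_minus mult_minus_right mult_minus_left minus_minus diff_minus_eq_add)
qed

lemma center_eq_solve_pq:
  assumes "det_pq r s f g \<noteq> 0"
  shows "center_eq p q r s f g \<longleftrightarrow>
    p = ((s - g) * (f + r) + (f * r + g * s - 1) * (s * f - r * g)) / det_pq r s f g \<and>
    q = ((f * s - g * r) * (s * f - r * g) - (g - s) * (s - g)) / det_pq r s f g"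
proof -
  have D: "(f * s - g * r) * (f + r) - (- (f * r + g * s - 1)) * (g - s) = det_pq r s f g"
    by (simp add: det_pq_def algebra_simps)
  have "center_eq p q r s f g \<longleftrightarrow>
      (f * s - g * r) * p + (- (f * r + g * s - 1)) * q = s - g \<and>
      (g - s) * p + (f + r) * q = s * f - r * g"
    unfolding center_eq_def by (auto simp: algebra_simps)
  also have "\<dots> \<longleftrightarrow> p = ((s - g) * (f + r) - - (f * r + g * s - 1) * (s * f - r * g)) / det_pq r s f g \<and>
      q = ((f * s - g * r) * (s * f - r * g) - (g - s) * (s - g)) / det_pq r s f g"
    unfolding D[symmetric] by (rule cramer_2) (simp only: D assms not_False_eq_True)
  finally show ?thesis by (simp only: mult_minus_left diff_minus_eq_add)
qed

text \<open>Let P, R, G be the quotients (p * p + q * q + 1) / q and likewise for (r, s) and (f, g).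
  The three determinants vanish exactly when P = R, G = - P and G = R respectively. Together these
  force P = 0, although its numerator is positive.\<close>

lemma some_det_nonzero:
  assumes "q \<noteq> 0" "s \<noteq> 0" "g \<noteq> 0"
  shows "det_fg p q r s \<noteq> 0 \<or> det_rs p q f g \<noteq> 0 \<or> det_pq r s f g \<noteq> 0"
proof (rule ccontr)
  assume "\<not> ?thesis"
  then have "(p * p + q * q + 1) / q = (r * r + s * s + 1) / s"
    "(f * f + g * g + 1) / g = - ((p * p + q * q + 1) / q)"
    "(f * f + g * g + 1) / g = (r * r + s * s + 1) / s"
    using assms by (auto simp: det_fg_def det_rs_def det_pq_def divide_simps algebra_simps)
  then have "(p * p + q * q + 1) / q = 0" by linarith
  then have "p * p + q * q + 1 = 0" using assms by simp
  then show False using zero_le_square[of p] zero_le_square[of q] by linarith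
qed

text \<open>The entries of the odd columns below the diagonal blocks. They do not occur in
  \<open>center_eq\<close> and serve as six of the ten coordinates in every chart.\<close>

definition common_entries :: "(6 \<times> 6) set" where
  "common_entries = {(3, 1), (4, 1), (5, 1), (6, 1), (5, 3), (6, 3)}"

definition slice_chart_at :: "nat \<Rightarrow> 'a::euclidean_space set \<Rightarrow> 'a \<Rightarrow> bool" where
  "slice_chart_at k M p \<longleftrightarrow> (\<exists>U V \<phi> \<psi> S. p \<in> U \<and> smooth_diffeomorphism U (V :: 'a set) \<phi> \<psi> \<and>
     subspace S \<and> dim S = k \<and> \<phi> ` (M \<inter> U) = S \<inter> V)"

text \<open>A common template for the three charts. The functions \<open>p\<close>, ...,
  \<open>g\<close> supply the six diagonal-block entries from the coordinates in \<open>I\<close>: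
  four of them are coordinates themselves, and two are the rational solutions of
  \<open>center_eq\<close>. Inserting them into \<open>J_of\<close> gives the map \<open>H\<close>
  for \<open>graph_chart\<close>.\<close>

lemma submanifold_chart:
  fixes p q r s f g :: "real ^ 6 ^ 6 \<Rightarrow> real"
  assumes U: "open U" "\<And>x. restrict_entries I x \<in> U \<longleftrightarrow> x \<in> U"
    and smooth: "smooth_on U p" "smooth_on U q" "smooth_on U r" "smooth_on U s"
      "smooth_on U f" "smooth_on U g"
    and nz: "\<And>x. x \<in> U \<Longrightarrow> q x \<noteq> 0 \<and> s x \<noteq> 0 \<and> g x \<noteq> 0"
    and restr: "\<And>x. p (restrict_entries I x) = p x" "\<And>x. q (restrict_entries I x) = q x"
      "\<And>x. r (restrict_entries I x) = r x" "\<And>x. s (restrict_entries I x) = s x"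
      "\<And>x. f (restrict_entries I x) = f x" "\<And>x. g (restrict_entries I x) = g x"
    and I: "card I = 10" "common_entries \<subseteq> I"
      "I \<subseteq> common_entries \<union> {(1, 1), (2, 1), (3, 3), (4, 3), (5, 5), (6, 5)}"
    and proj: "\<And>x. (1, 1) \<in> I \<Longrightarrow> p x = x$1$1" "\<And>x. (2, 1) \<in> I \<Longrightarrow> q x = x$2$1"
      "\<And>x. (3, 3) \<in> I \<Longrightarrow> r x = x$3$3" "\<And>x. (4, 3) \<in> I \<Longrightarrow> s x = x$4$3"
      "\<And>x. (5, 5) \<in> I \<Longrightarrow> f x = x$5$5" "\<And>x. (6, 5) \<in> I \<Longrightarrow> g x = x$6$5"
    and sol: "\<And>x. x \<in> U \<Longrightarrow>
      center_eq (x$1$1) (x$2$1) (x$3$3) (x$4$3) (x$5$5) (x$6$5) \<longleftrightarrow>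
      x$1$1 = p x \<and> x$2$1 = q x \<and> x$3$3 = r x \<and> x$4$3 = s x \<and> x$5$5 = f x \<and> x$6$5 = g x"
    and "A \<in> U"
  shows "slice_chart_at 10 X_M10 A"
proof -
  define H where "H x = J_of (p x) (q x) (r x) (s x) (f x) (g x)
    (x$3$1) (x$4$1) (x$5$1) (x$6$1) (x$5$3) (x$6$3)" for x
  have entries: "H x $ 1 $ 1 = p x" "H x $ 2 $ 1 = q x" "H x $ 3 $ 3 = r x" "H x $ 4 $ 3 = s x"
    "H x $ 5 $ 5 = f x" "H x $ 6 $ 5 = g x" "H x $ 3 $ 1 = x$3$1" "H x $ 4 $ 1 = x$4$1"
    "H x $ 5 $ 1 = x$5$1" "H x $ 6 $ 1 = x$6$1" "H x $ 5 $ 3 = x$5$3" "H x $ 6 $ 3 = x$6$3" for x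
    by (simp_all add: H_def J_of_def Let_def)
  have 1: "smooth_on U H"
    unfolding H_def[abs_def] using nz by (intro smooth_on_J_of U smooth smooth_on_entry) auto
  have 2: "H (restrict_entries I x) = H x" for x
  proof -
    have "restrict_entries I x $ i $ j = x $ i $ j" if "(i, j) \<in> common_entries" for i j
      using that I by (auto simp: restrict_entries_def)
    then show ?thesis by (simp add: H_def restr common_entries_def)
  qed
  \<comment> \<open>\<open>H\<close> recomputes the dependent entries but reproduces every
    coordinate in \<open>I\<close>.\<close>
  have 3: "restrict_entries I (H x) = restrict_entries I x" for x
  proof -
    have "H x $ i $ j = x $ i $ j" if "(i, j) \<in> I" for i j
    proof -
      have "(i, j) \<in> common_entries \<union> {(1, 1), (2, 1), (3, 3), (4, 3), (5, 5), (6, 5)}"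
        using that I by blast
      then show ?thesis
        using that entries[of x] proj[of x] unfolding common_entries_def by auto
    qed
    then show ?thesis by (simp add: restrict_entries_def vec_eq_iff)
  qed
  have 4: "x \<in> X_M10 \<longleftrightarrow> x = H x" if "x \<in> U" for x
  proof
    assume "x \<in> X_M10"
    then have eq: "x = J_of (x$1$1) (x$2$1) (x$3$3) (x$4$3) (x$5$5) (x$6$5)
        (x$3$1) (x$4$1) (x$5$1) (x$6$1) (x$5$3) (x$6$3)"
      and entries: "x$1$1 = p x" "x$2$1 = q x" "x$3$3 = r x" "x$4$3 = s x" "x$5$5 = f x" "x$6$5 = g x"
      using sol[OF that] by (auto simp only: X_M10_iff)
    show "x = H x" unfolding H_def by (rule eq[unfolded entries])
  next
    assume eq: "x = H x"
    have "x$1$1 = p x" "x$2$1 = q x" "x$3$3 = r x" "x$4$3 = s x" "x$5$5 = f x" "x$6$5 = g x"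
      using eq entries[of x] by simp_all
    then show "x \<in> X_M10"
      using eq sol[OF that] nz[OF that] unfolding X_M10_iff H_def by simp
  qed
  have "\<exists>V \<phi> \<psi>. smooth_diffeomorphism U V \<phi> \<psi> \<and> \<phi> ` (X_M10 \<inter> U) = range (restrict_entries I) \<inter> V"
    by (rule graph_chart[OF U(1) linear_restrict_entries _ U(2) 1 2 3 4])
      (auto simp: restrict_entries_def vec_eq_iff)
  moreover have "subspace (range (restrict_entries I))"
    using linear_subspace_image[OF linear_restrict_entries subspace_UNIV] .
  ultimately show ?thesis
    using dim_range_restrict_entries[of I] I(1) \<open>A \<in> U\<close> unfolding slice_chart_at_def by metis
qed

section \<open>The three families of charts\<close>

lemma card_entries: "card (common_entries \<union> {a, b, c, d}) = 10"
  if "distinct [a, b, c, d]" "{a, b, c, d} \<inter> common_entries = {}"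
  using that by (subst card_Un_disjoint) (auto simp: common_entries_def)

lemmas smooth_intros = smooth_on_add smooth_on_diff smooth_on_mult smooth_on_divide smooth_on_const
  smooth_on_entry

lemma restrict_entries_nth: "restrict_entries I x $ i $ j = (if (i, j) \<in> I then x $ i $ j else 0)"
  by (simp add: restrict_entries_def)

lemma chart_fg:
  assumes A: "A \<in> X_M10" and D: "det_fg (A$1$1) (A$2$1) (A$3$3) (A$4$3) \<noteq> 0"
  shows "slice_chart_at 10 X_M10 A"
proof -
  define d where "d x = det_fg (x$1$1) (x$2$1) (x$3$3) (x$4$3)" for x :: "real ^ 6 ^ 6"
  define M where "M x = (x$4$3 - x$2$1) * (x$1$1 + x$3$3) +
    (x$1$1 * x$3$3 + x$2$1 * x$4$3 - 1) * (x$1$1 * x$4$3 - x$2$1 * x$3$3)" for x :: "real ^ 6 ^ 6"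
  define N where "N x = (x$1$1 * x$4$3 - x$2$1 * x$3$3) * (x$1$1 * x$4$3 - x$2$1 * x$3$3) +
    (x$4$3 - x$2$1) * (x$4$3 - x$2$1)" for x :: "real ^ 6 ^ 6"
  \<comment> \<open>The solved value of g is N x / d x, and \<open>J_of\<close> divides by it.
    Requiring \<open>N x\<close> rather than x$6$5 to be nonzero makes \<open>U\<close> depend only
    on the entries in \<open>I\<close>.\<close>
  define U where "U = {x. x$2$1 \<noteq> 0 \<and> x$4$3 \<noteq> 0 \<and> d x \<noteq> 0 \<and> N x \<noteq> 0}"
  define I :: "(6 \<times> 6) set" where "I = common_entries \<union> {(1, 1), (2, 1), (3, 3), (4, 3)}"
  have sol: "center_eq (x$1$1) (x$2$1) (x$3$3) (x$4$3) (x$5$5) (x$6$5) \<longleftrightarrow>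
      x$5$5 = M x / d x \<and> x$6$5 = N x / d x" if "d x \<noteq> 0" for x
    using center_eq_solve_fg that by (simp add: d_def N_def M_def)
  have "open U"
    unfolding U_def d_def N_def det_fg_def by (intro open_Collect_conj open_Collect_neq continuous_intros)
  have nz: "d x \<noteq> 0" if "x \<in> U" for x using that by (simp add: U_def)
  have smooth: "smooth_on U d" "smooth_on U M" "smooth_on U N"
    unfolding M_def[abs_def] N_def[abs_def] d_def[abs_def] det_fg_def
    by (intro smooth_intros \<open>open U\<close>)+
  have restr: "d (restrict_entries I x) = d x" "M (restrict_entries I x) = M x"
    "N (restrict_entries I x) = N x" for x
    by (simp_all add: d_def M_def N_def restrict_entries_nth I_def)
  show ?thesis
  proof (rule submanifold_chart[where I = I and U = U and p = "\<lambda>x. x$1$1" and q = "\<lambda>x. x$2$1"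
        and r = "\<lambda>x. x$3$3" and s = "\<lambda>x. x$4$3" and f = "\<lambda>x. M x / d x" and g = "\<lambda>x. N x / d x"])
    show "card I = 10"
      unfolding I_def by (rule card_entries) (auto simp: common_entries_def)
    show "A \<in> U"
      using A D sol[of A] by (auto simp: U_def d_def X_M10_iff)
    show "restrict_entries I x \<in> U \<longleftrightarrow> x \<in> U" for x
      by (simp add: U_def restr) (simp add: restrict_entries_nth I_def)
    show "common_entries \<subseteq> I" "I \<subseteq> common_entries \<union> {(1, 1), (2, 1), (3, 3), (4, 3), (5, 5), (6, 5)}"
      by (auto simp: I_def)
    show "M x / d x = x$5$5" if "(5, 5) \<in> I" for x
      using that by (simp add: I_def common_entries_def)
    show "N x / d x = x$6$5" if "(6, 5) \<in> I" for x
      using that by (simp add: I_def common_entries_def)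
    show "smooth_on U (\<lambda>x. M x / d x)" "smooth_on U (\<lambda>x. N x / d x)"
      by (intro smooth_on_divide smooth nz \<open>open U\<close>; assumption)+
    show "x$2$1 \<noteq> 0 \<and> x$4$3 \<noteq> 0 \<and> N x / d x \<noteq> 0" if "x \<in> U" for x
      using that by (simp add: U_def)
    show "center_eq (x$1$1) (x$2$1) (x$3$3) (x$4$3) (x$5$5) (x$6$5) \<longleftrightarrow>
        x$1$1 = x$1$1 \<and> x$2$1 = x$2$1 \<and> x$3$3 = x$3$3 \<and> x$4$3 = x$4$3 \<and> x$5$5 = M x / d x \<and> x$6$5 = N x / d x" if "x \<in> U" for x
      by (simp only: sol[OF nz[OF that]] simp_thms)
  qed (simp_all add: \<open>open U\<close> smooth_on_entry restr, simp_all add: restrict_entries_nth I_def)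
qed

lemma chart_rs:
  assumes A: "A \<in> X_M10" and D: "det_rs (A$1$1) (A$2$1) (A$5$5) (A$6$5) \<noteq> 0"
  shows "slice_chart_at 10 X_M10 A"
proof -
  define d where "d x = det_rs (x$1$1) (x$2$1) (x$5$5) (x$6$5)" for x :: "real ^ 6 ^ 6"
  define M where "M x = (x$2$1 + x$6$5) * (x$5$5 + x$1$1) +
    (x$5$5 * x$1$1 - x$6$5 * x$2$1 - 1) * (x$1$1 * x$6$5 + x$2$1 * x$5$5)" for x :: "real ^ 6 ^ 6"
  define N where "N x = (x$5$5 * x$2$1 + x$6$5 * x$1$1) * (x$1$1 * x$6$5 + x$2$1 * x$5$5) +
    (x$6$5 + x$2$1) * (x$2$1 + x$6$5)" for x :: "real ^ 6 ^ 6"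
  \<comment> \<open>Now \<open>N\<close> stands in for the dependent entry s.\<close>
  define U where "U = {x. x$2$1 \<noteq> 0 \<and> x$6$5 \<noteq> 0 \<and> d x \<noteq> 0 \<and> N x \<noteq> 0}"
  define I :: "(6 \<times> 6) set" where "I = common_entries \<union> {(1, 1), (2, 1), (5, 5), (6, 5)}"
  have sol: "center_eq (x$1$1) (x$2$1) (x$3$3) (x$4$3) (x$5$5) (x$6$5) \<longleftrightarrow>
      x$3$3 = M x / d x \<and> x$4$3 = N x / d x" if "d x \<noteq> 0" for x
    using center_eq_solve_rs that by (simp add: d_def N_def M_def)
  have "open U"
    unfolding U_def d_def N_def det_rs_def by (intro open_Collect_conj open_Collect_neq continuous_intros)
  have nz: "d x \<noteq> 0" if "x \<in> U" for x using that by (simp add: U_def)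
  have smooth: "smooth_on U d" "smooth_on U M" "smooth_on U N"
    unfolding M_def[abs_def] N_def[abs_def] d_def[abs_def] det_rs_def
    by (intro smooth_intros \<open>open U\<close>)+
  have restr: "d (restrict_entries I x) = d x" "M (restrict_entries I x) = M x"
    "N (restrict_entries I x) = N x" for x
    by (simp_all add: d_def M_def N_def restrict_entries_nth I_def)
  show ?thesis
  proof (rule submanifold_chart[where I = I and U = U and p = "\<lambda>x. x$1$1" and q = "\<lambda>x. x$2$1"
        and f = "\<lambda>x. x$5$5" and g = "\<lambda>x. x$6$5" and r = "\<lambda>x. M x / d x" and s = "\<lambda>x. N x / d x"])
    show "card I = 10"
      unfolding I_def by (rule card_entries) (auto simp: common_entries_def)
    show "A \<in> U"
      using A D sol[of A] by (auto simp: U_def d_def X_M10_iff)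
    show "restrict_entries I x \<in> U \<longleftrightarrow> x \<in> U" for x
      by (simp add: U_def restr) (simp add: restrict_entries_nth I_def)
    show "common_entries \<subseteq> I" "I \<subseteq> common_entries \<union> {(1, 1), (2, 1), (3, 3), (4, 3), (5, 5), (6, 5)}"
      by (auto simp: I_def)
    show "M x / d x = x$3$3" if "(3, 3) \<in> I" for x
      using that by (simp add: I_def common_entries_def)
    show "N x / d x = x$4$3" if "(4, 3) \<in> I" for x
      using that by (simp add: I_def common_entries_def)
    show "smooth_on U (\<lambda>x. M x / d x)" "smooth_on U (\<lambda>x. N x / d x)"
      by (intro smooth_on_divide smooth nz \<open>open U\<close>; assumption)+
    show "x$2$1 \<noteq> 0 \<and> N x / d x \<noteq> 0 \<and> x$6$5 \<noteq> 0" if "x \<in> U" for x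
      using that by (simp add: U_def)
    show "center_eq (x$1$1) (x$2$1) (x$3$3) (x$4$3) (x$5$5) (x$6$5) \<longleftrightarrow>
        x$1$1 = x$1$1 \<and> x$2$1 = x$2$1 \<and> x$3$3 = M x / d x \<and> x$4$3 = N x / d x \<and> x$5$5 = x$5$5 \<and> x$6$5 = x$6$5" if "x \<in> U" for x
      by (simp only: sol[OF nz[OF that]] simp_thms)
  qed (simp_all add: \<open>open U\<close> smooth_on_entry restr, simp_all add: restrict_entries_nth I_def)
qed

lemma chart_pq:
  assumes A: "A \<in> X_M10" and D: "det_pq (A$3$3) (A$4$3) (A$5$5) (A$6$5) \<noteq> 0"
  shows "slice_chart_at 10 X_M10 A"
proof -
  define d where "d x = det_pq (x$3$3) (x$4$3) (x$5$5) (x$6$5)" for x :: "real ^ 6 ^ 6"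
  define M where "M x = (x$4$3 - x$6$5) * (x$5$5 + x$3$3) +
    (x$5$5 * x$3$3 + x$6$5 * x$4$3 - 1) * (x$4$3 * x$5$5 - x$3$3 * x$6$5)" for x :: "real ^ 6 ^ 6"
  define N where "N x = (x$5$5 * x$4$3 - x$6$5 * x$3$3) * (x$4$3 * x$5$5 - x$3$3 * x$6$5) -
    (x$6$5 - x$4$3) * (x$4$3 - x$6$5)" for x :: "real ^ 6 ^ 6"
  \<comment> \<open>Now \<open>N\<close> stands in for the dependent entry q.\<close>
  define U where "U = {x. x$4$3 \<noteq> 0 \<and> x$6$5 \<noteq> 0 \<and> d x \<noteq> 0 \<and> N x \<noteq> 0}"
  define I :: "(6 \<times> 6) set" where "I = common_entries \<union> {(3, 3), (4, 3), (5, 5), (6, 5)}"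
  have sol: "center_eq (x$1$1) (x$2$1) (x$3$3) (x$4$3) (x$5$5) (x$6$5) \<longleftrightarrow>
      x$1$1 = M x / d x \<and> x$2$1 = N x / d x" if "d x \<noteq> 0" for x
    using center_eq_solve_pq that by (simp add: d_def N_def M_def)
  have "open U"
    unfolding U_def d_def N_def det_pq_def by (intro open_Collect_conj open_Collect_neq continuous_intros)
  have nz: "d x \<noteq> 0" if "x \<in> U" for x using that by (simp add: U_def)
  have smooth: "smooth_on U d" "smooth_on U M" "smooth_on U N"
    unfolding M_def[abs_def] N_def[abs_def] d_def[abs_def] det_pq_def
    by (intro smooth_intros \<open>open U\<close>)+
  have restr: "d (restrict_entries I x) = d x" "M (restrict_entries I x) = M x"
    "N (restrict_entries I x) = N x" for x
    by (simp_all add: d_def M_def N_def restrict_entries_nth I_def)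
  show ?thesis
  proof (rule submanifold_chart[where I = I and U = U and r = "\<lambda>x. x$3$3" and s = "\<lambda>x. x$4$3"
        and f = "\<lambda>x. x$5$5" and g = "\<lambda>x. x$6$5" and p = "\<lambda>x. M x / d x" and q = "\<lambda>x. N x / d x"])
    show "card I = 10"
      unfolding I_def by (rule card_entries) (auto simp: common_entries_def)
    show "A \<in> U"
      using A D sol[of A] by (auto simp: U_def d_def X_M10_iff)
    show "restrict_entries I x \<in> U \<longleftrightarrow> x \<in> U" for x
      by (simp add: U_def restr) (simp add: restrict_entries_nth I_def)
    show "common_entries \<subseteq> I" "I \<subseteq> common_entries \<union> {(1, 1), (2, 1), (3, 3), (4, 3), (5, 5), (6, 5)}"
      by (auto simp: I_def)
    show "M x / d x = x$1$1" if "(1, 1) \<in> I" for x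
      using that by (simp add: I_def common_entries_def)
    show "N x / d x = x$2$1" if "(2, 1) \<in> I" for x
      using that by (simp add: I_def common_entries_def)
    show "smooth_on U (\<lambda>x. M x / d x)" "smooth_on U (\<lambda>x. N x / d x)"
      by (intro smooth_on_divide smooth nz \<open>open U\<close>; assumption)+
    show "N x / d x \<noteq> 0 \<and> x$4$3 \<noteq> 0 \<and> x$6$5 \<noteq> 0" if "x \<in> U" for x
      using that by (simp add: U_def)
    show "center_eq (x$1$1) (x$2$1) (x$3$3) (x$4$3) (x$5$5) (x$6$5) \<longleftrightarrow>
        x$1$1 = M x / d x \<and> x$2$1 = N x / d x \<and> x$3$3 = x$3$3 \<and> x$4$3 = x$4$3 \<and> x$5$5 = x$5$5 \<and> x$6$5 = x$6$5" if "x \<in> U" for x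
      by (simp only: sol[OF nz[OF that]] simp_thms)
  qed (simp_all add: \<open>open U\<close> smooth_on_entry restr, simp_all add: restrict_entries_nth I_def)
qed

theorem mainTheorem8:
  shows "smooth_submanifold 10 X_M10"
proof -
  \<comment> \<open>The structure sending x1 to x2, x3 to x4 and x5 to x6 shows that the set is
    nonempty.\<close>
  have "J_of 0 1 0 1 0 1 0 0 0 0 0 0 \<in> X_M10"
    unfolding X_M10_iff by (simp add: J_of_def Let_def center_eq_def)
  then have "X_M10 \<noteq> {}" by blast
  moreover have "slice_chart_at 10 X_M10 A" if A: "A \<in> X_M10" for A
  proof -
    have "A$2$1 \<noteq> 0" "A$4$3 \<noteq> 0" "A$6$5 \<noteq> 0"
      using A by (simp_all add: X_M10_iff)
    from some_det_nonzero[OF this, of "A$1$1" "A$3$3" "A$5$5"] show ?thesis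
      using chart_fg[OF A] chart_rs[OF A] chart_pq[OF A] by blast
  qed
  ultimately show ?thesis
    by (simp add: smooth_submanifold_def slice_chart_at_def)
qed

end
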